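(* Let $\nu,\mu\in\mathbb{C}$ and $\xi\in(0,\infty)$. The following identities hold. (i) If $\mathrm{Re}(\nu+\mu)>-1$, then $$\int_0^\infty e^{-t\cosh\xi}\,t^\nu I_\mu(t\sinh\xi)\,dt=\left(\frac{2}{\pi}\right)^{1/2}(\sinh\xi)^{-1/2}\,e^{-(\nu+1/2)\pi i}\,Q_{\mu-1/2}^{\nu+1/2}(\coth\xi).$$ (ii) If $\mathrm{Re}(\nu+\mu)>-1$ and $\mathrm{Re}(\nu-\mu)>-1$, then $$\int_0^\infty e^{-t\cosh\xi}\,t^\nu K_\mu(t\sinh\xi)\,dt=\left(\frac{\pi}{2}\right)^{1/2}\Gamma(\nu+\mu+1)\,\Gamma(\nu-\mu+1)\,(\sinh\xi)^{-1/2}\,P_{\mu-1/2}^{-\nu-1/2}(\coth\xi).$$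
   Context: $I_\mu,K_\mu$ are the modified Bessel functions of the first and second kind ($K_\mu$ is MacDonald's function, with its standard normalization $K_\mu=\frac{\pi}{2}\,\frac{I_{-\mu}-I_\mu}{\sin(\mu\pi)}$, by limit for integer $\mu$). $P_\nu^\mu,Q_\nu^\mu$ denote the associated Legendre functions of degree $\nu$ and order $\mu$ defined off the cut $(-\infty,1]$ (here with argument in $(1,\infty)$), with $Q_\nu^\mu$ in Hobson's normalization. Explicitly, let $\mathbf{F}(a,b;c;z)=\sum_{n\ge0}\frac{(a)_n(b)_n}{\Gamma(c+n)\,n!}z^n$ for $|z|<1$ denote the regularized Gauss hypergeometric function, $(a)_n$ being the Pochhammer symbol. All powers of positive numbers are principal. For $x\in(1,\infty)$: $$P_\nu^\mu(x)=\left(\frac{x+1}{x-1}\right)^{\mu/2}\mathbf{F}\left(\nu+1,-\nu;1-\mu;\tfrac{1-x}{2}\right)$$ (with $\mathbf{F}$ analytically continued in its last argument to the complement of $[1,\infty)$), and $$Q_\nu^\mu(x)=e^{\mu\pi i}\,\Gamma(\nu+\mu+1)\,\frac{\pi^{1/2}(x^2-1)^{\mu/2}}{2^{\nu+1}x^{\nu+\mu+1}}\,\mathbf{F}\left(\tfrac{\nu+\mu}{2}+1,\tfrac{\nu+\mu+1}{2};\nu+\tfrac32;\tfrac1{x^2}\right),$$ where $\nu+\mu$ is not a negative integer. *)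

theory Defs
  imports "HOL-Complex_Analysis.Complex_Analysis"
begin

section \<open>Modified Bessel functions\<close>

text \<open>
  The library's \<^const>\<open>rGamma\<close> is the entire function $1/\Gamma$, so all series below make
  sense for every complex value of the parameters. Powers are principal.
\<close>

definition bessel_I :: "complex \<Rightarrow> complex \<Rightarrow> complex" where
  "bessel_I \<mu> z =
     (\<Sum>k. (z / 2) powr (\<mu> + 2 * of_nat k) * rGamma (\<mu> + of_nat k + 1) / fact k)"

definition bessel_K_quot :: "complex \<Rightarrow> complex \<Rightarrow> complex" where
  "bessel_K_quot z \<mu> =
     of_real pi / 2 * ((bessel_I (- \<mu>) z - bessel_I \<mu> z) / sin (\<mu> * of_real pi))"

definition bessel_K :: "complex \<Rightarrow> complex \<Rightarrow> complex" where
  "bessel_K \<mu> z =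
     (if \<mu> \<in> \<int> then Lim (at \<mu>) (bessel_K_quot z) else bessel_K_quot z \<mu>)"


section \<open>The regularized Gauss hypergeometric function\<close>

definition hypergeom_reg_series :: "complex \<Rightarrow> complex \<Rightarrow> complex \<Rightarrow> complex \<Rightarrow> complex" where
  "hypergeom_reg_series a b c z =
     (\<Sum>n. pochhammer a n * pochhammer b n * rGamma (c + of_nat n) / fact n * z ^ n)"

definition slit_plane :: "complex set" where
  "slit_plane = - (complex_of_real ` {1..})"

definition is_hypergeom_reg_continuation ::
    "complex \<Rightarrow> complex \<Rightarrow> complex \<Rightarrow> (complex \<Rightarrow> complex) \<Rightarrow> bool" where
  "is_hypergeom_reg_continuation a b c f \<longleftrightarrow>
     f holomorphic_on slit_plane \<and> (\<forall>z\<in>ball 0 1. f z = hypergeom_reg_series a b c z)"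

text \<open>
  The description is applied to the value of the continuation at \<open>z\<close>, since the continuation as
  a function on the whole type is not determined on the cut.
\<close>

definition hypergeom_reg :: "complex \<Rightarrow> complex \<Rightarrow> complex \<Rightarrow> complex \<Rightarrow> complex" where
  "hypergeom_reg a b c z = (THE w. \<exists>f. is_hypergeom_reg_continuation a b c f \<and> f z = w)"

lemma open_slit_plane: "open slit_plane"
proof -
  have "complex_of_real ` {1..} = {z. Im z = 0} \<inter> {z. Re z \<ge> 1}"
    by (auto simp: complex_eq_iff image_iff)
  moreover have "closed {z. Im z = 0}" "closed {z. Re z \<ge> 1}"
    using closed_halfspace_Im_eq[of 0] closed_halfspace_Re_ge[of 1] by simp_all
  ultimately show ?thesis
    unfolding slit_plane_def by (simp only: open_Compl closed_Int)
qed

lemma starlike_slit_plane: "starlike slit_plane"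
  unfolding starlike_def
proof (intro bexI[of _ 0] ballI)
  show "0 \<in> slit_plane"
    by (auto simp: slit_plane_def)
  fix z assume z: "z \<in> slit_plane"
  show "closed_segment 0 z \<subseteq> slit_plane"
  proof
    fix w assume "w \<in> closed_segment 0 z"
    then obtain u where u: "0 \<le> u" "u \<le> 1" "w = of_real u * z"
      by (auto simp: in_segment scaleR_conv_of_real)
    show "w \<in> slit_plane"
    proof (rule ccontr)
      assume "w \<notin> slit_plane"
      then obtain r where r: "r \<ge> 1" "of_real u * z = of_real r"
        using u by (auto simp: slit_plane_def)
      have "u \<noteq> 0"
        using r by (intro notI) simp
      then have z_eq: "z = of_real (r / u)"
        using r(2) by (simp add: nonzero_eq_divide_eq mult.commute)
      have "r / u \<ge> 1"
        using r(1) u(1,2) \<open>u \<noteq> 0\<close> by (simp add: pos_le_divide_eq)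
      then have "z \<in> complex_of_real ` {1..}"
        unfolding z_eq by (intro imageI) simp
      then show False
        using z by (simp add: slit_plane_def)
    qed
  qed
qed

lemma hypergeom_reg_eqI:
  assumes f: "is_hypergeom_reg_continuation a b c f" and z: "z \<in> slit_plane"
  shows "hypergeom_reg a b c z = f z"
  unfolding hypergeom_reg_def
proof (rule the_equality)
  show "\<exists>g. is_hypergeom_reg_continuation a b c g \<and> g z = f z"
    using f by blast
next
  fix w assume "\<exists>g. is_hypergeom_reg_continuation a b c g \<and> g z = w"
  then obtain g where g: "is_hypergeom_reg_continuation a b c g" "g z = w"
    by blast
  have "ball 0 1 \<subseteq> slit_plane"
  proof
    fix u :: complex assume "u \<in> ball 0 1"
    then have "norm u < 1"
      by simp
    then show "u \<in> slit_plane"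
      unfolding slit_plane_def by force
  qed
  moreover have "ball 0 1 \<noteq> ({} :: complex set)"
    by simp
  moreover have "g holomorphic_on slit_plane" "f holomorphic_on slit_plane"
    using f g(1) unfolding is_hypergeom_reg_continuation_def by blast+
  moreover have "g u = f u" if "u \<in> ball 0 1" for u
    using f g(1) that unfolding is_hypergeom_reg_continuation_def by metis
  ultimately have "g z = f z"
    using analytic_continuation_open[OF open_ball open_slit_plane _
        starlike_imp_connected[OF starlike_slit_plane], of 0 1 g f z] z
    by blast
  then show "w = f z"
    using g by simp
qed


section \<open>Associated Legendre functions off the cut\<close>

text \<open>
  The first argument is the degree, the second one the order; the functions are meant for
  real arguments greater than \<open>1\<close>.
\<close>

definition legendre_P :: "complex \<Rightarrow> complex \<Rightarrow> real \<Rightarrow> complex" where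
  "legendre_P \<nu> \<mu> x =
     of_real ((x + 1) / (x - 1)) powr (\<mu> / 2) *
     hypergeom_reg (\<nu> + 1) (- \<nu>) (1 - \<mu>) (of_real ((1 - x) / 2))"

text \<open>Hobson's normalization, for \<open>\<nu> + \<mu>\<close> not a negative integer.\<close>

definition legendre_Q :: "complex \<Rightarrow> complex \<Rightarrow> real \<Rightarrow> complex" where
  "legendre_Q \<nu> \<mu> x =
     exp (\<mu> * of_real pi * \<i>) * Gamma (\<nu> + \<mu> + 1) *
     (of_real (sqrt pi) * of_real (x\<^sup>2 - 1) powr (\<mu> / 2) /
      (2 powr (\<nu> + 1) * of_real x powr (\<nu> + \<mu> + 1))) *
     hypergeom_reg_series ((\<nu> + \<mu>) / 2 + 1) ((\<nu> + \<mu> + 1) / 2) (\<nu> + 3 / 2) (of_real (1 / x\<^sup>2))"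

end

theory Submission
  imports Defs
begin

text \<open>
  Write \<open>c = cosh \<xi>\<close> and \<open>s = sinh \<xi>\<close>, so that \<open>0 < s < c\<close>.

  (i) Inserting the power series of \<open>I\<^sub>\<mu>\<close> and integrating term by term reduces the claim to
  \<open>\<integral> t\<^sup>(\<^sup>a\<^sup>-\<^sup>1\<^sup>) exp (- c t) dt = \<Gamma>(a) c\<^sup>-\<^sup>a\<close> with \<open>a = \<nu> + \<mu> + 1 + 2 k\<close>.
  The duplication formula for Pochhammer symbols turns \<open>\<Gamma>(a)\<close> into the numerator of a
  hypergeometric series in \<open>(s / c)\<^sup>2 < 1\<close>, which is the one in the definition of \<open>Q\<close>; the same
  computation with real parts of the exponents justifies the interchange
  (\<open>Laplace_bessel_I\<close>, \<open>legendre_Q_coth\<close>).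

  (ii) Combining (i) for \<open>\<mu>\<close> and \<open>- \<mu>\<close> would leave a connection formula between hypergeometric
  functions of different arguments to be proved. Instead everything is computed from the integral
  \<open>2 K\<^sub>\<mu>(z) = \<integral> exp (- z cosh v - \<mu> v) dv\<close> over the real line.

  That this integral is MacDonald's function as defined by \<open>I\<^sub>\<mu>\<close> and \<open>I\<^sub>-\<^sub>\<mu>\<close>
  (\<open>bessel_K_eq_integral\<close>) follows from Wronskians. The integral satisfies the recurrence and the
  differential relations of MacDonald's function, hence
  \<open>z (I\<^sub>\<mu> K\<^sub>\<mu>\<^sub>+\<^sub>1 + I\<^sub>\<mu>\<^sub>+\<^sub>1 K\<^sub>\<mu>)\<close> does not depend on \<open>z\<close>, and its limit for
  \<open>z \<rightarrow> 0\<close> is \<open>1\<close>. Together with the same identity for \<open>- \<mu>\<close> and the Wronskian of \<open>I\<^sub>\<mu>\<close>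
  and \<open>I\<^sub>-\<^sub>\<mu>\<close>, this is a linear system whose solution is the defining quotient. For integer
  order both sides are limits in \<open>\<mu>\<close>.

  With \<open>a = \<nu> + 1\<close>, Fubini's theorem and the Gamma integral in \<open>t\<close> give
  \<open>\<Gamma>(a) / 2 \<cdot> \<integral> exp (- \<mu> v) (c + s cosh v)\<^sup>-\<^sup>a dv\<close> for the left-hand side of (ii). Since
  \<open>c / s + cosh v = (1 + cosh v) (1 - z \<theta>(v))\<close> for \<open>z = (1 - c / s) / 2\<close> and
  \<open>\<theta>(v) = 2 / (1 + cosh v) \<in> (0, 1]\<close>, this is a multiple of
  \<open>f(z) = \<integral> exp (- \<mu> v) (1 + cosh v)\<^sup>-\<^sup>a (1 - z \<theta>(v))\<^sup>-\<^sup>a dv\<close>.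
  The function \<open>f\<close> is holomorphic off the cut, and the binomial series together with the Beta
  integral identifies it for \<open>|z| < 1\<close> as a multiple of \<open>F(a - \<mu>, a + \<mu>; a + 1/2; z)\<close>
  (\<open>hyp_integral_eq_series\<close>). Euler's transformation \<open>Euler_transformation\<close> turns this into
  \<open>F(1/2 - \<mu>, 1/2 + \<mu>; a + 1/2; z)\<close>, the function in the definition of \<open>P\<close>, and so
  \<open>(1 - z)\<^sup>(\<^sup>a\<^sup>-\<^sup>1\<^sup>/\<^sup>2\<^sup>) f(z)\<close> is, up to the constant, the analytic continuation that
  this definition asks for (\<open>hypergeom_reg_eq_integral\<close>, \<open>legendre_P_coth\<close>).
\<close>

section \<open>Lebesgue integrals depending on a parameter\<close>

text \<open>
  The difference quotients are bounded by \<open>g\<close> because of the mean value inequality on the convex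
  set \<open>S\<close>, so dominated convergence applies to them.
\<close>

lemma has_field_derivative_integral_dominated:
  fixes f f' :: "complex \<Rightarrow> 'a \<Rightarrow> complex"
  assumes S: "open S" "convex S" "z0 \<in> S"
    and int: "\<And>z. z \<in> S \<Longrightarrow> integrable M (f z)"
    and deriv: "\<And>z x. z \<in> S \<Longrightarrow> x \<in> space M \<Longrightarrow> ((\<lambda>z. f z x) has_field_derivative f' z x) (at z)"
    and meas: "f' z0 \<in> borel_measurable M"
    and g: "integrable M g" "\<And>z x. z \<in> S \<Longrightarrow> x \<in> space M \<Longrightarrow> norm (f' z x) \<le> g x"
  shows "((\<lambda>z. \<integral>x. f z x \<partial>M) has_field_derivative (\<integral>x. f' z0 x \<partial>M)) (at z0)"
proof -
  have "((\<lambda>z. ((\<integral>x. f z x \<partial>M) - (\<integral>x. f z0 x \<partial>M)) / (z - z0)) \<longlongrightarrow> (\<integral>x. f' z0 x \<partial>M))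
          (at z0 within S)"
    unfolding tendsto_at_iff_sequentially comp_def
  proof (intro allI impI)
    fix X :: "nat \<Rightarrow> complex"
    assume X: "\<forall>i. X i \<in> S - {z0}" and lim: "X \<longlonglongrightarrow> z0"
    have "(\<lambda>n. \<integral>x. (f (X n) x - f z0 x) / (X n - z0) \<partial>M) \<longlonglongrightarrow> (\<integral>x. f' z0 x \<partial>M)"
    proof (rule integral_dominated_convergence[where w = g])
      show "AE x in M. (\<lambda>n. (f (X n) x - f z0 x) / (X n - z0)) \<longlonglongrightarrow> f' z0 x"
      proof (rule AE_I2)
        fix x assume x: "x \<in> space M"
        have "((\<lambda>z. (f z x - f z0 x) / (z - z0)) \<longlongrightarrow> f' z0 x) (at z0)"
          using deriv[OF S(3) x] unfolding has_field_derivative_iff by simp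
        then have "\<forall>X. (\<forall>i. X i \<in> UNIV - {z0}) \<longrightarrow> X \<longlonglongrightarrow> z0 \<longrightarrow>
            (\<lambda>n. (f (X n) x - f z0 x) / (X n - z0)) \<longlonglongrightarrow> f' z0 x"
          unfolding tendsto_at_iff_sequentially comp_def .
        moreover have "\<forall>i. X i \<in> UNIV - {z0}"
          using X by blast
        ultimately show "(\<lambda>n. (f (X n) x - f z0 x) / (X n - z0)) \<longlonglongrightarrow> f' z0 x"
          using lim by (elim allE[of _ X] impE)
      qed
      show "AE x in M. norm ((f (X n) x - f z0 x) / (X n - z0)) \<le> g x" for n
      proof (rule AE_I2)
        fix x assume x: "x \<in> space M"
        have Xn: "X n \<in> S" "X n \<noteq> z0"
          using X by auto
        have "norm (f (X n) x - f z0 x) \<le> g x * norm (X n - z0)"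
          by (rule field_differentiable_bound[where f' = "\<lambda>z. f' z x", OF S(2)
                has_field_derivative_at_within[OF deriv[OF _ x]] g(2)[OF _ x] Xn(1) S(3)])
        then show "norm ((f (X n) x - f z0 x) / (X n - z0)) \<le> g x"
          using Xn(2) by (simp add: norm_divide divide_le_eq)
      qed
      show "(\<lambda>x. (f (X n) x - f z0 x) / (X n - z0)) \<in> borel_measurable M" for n
      proof -
        have "X n \<in> S"
          using X by blast
        then show ?thesis
          by (intro borel_measurable_divide borel_measurable_diff borel_measurable_const
                borel_measurable_integrable int S(3))
      qed
    qed (fact meas, fact g(1))
    moreover have "(\<integral>x. (f (X n) x - f z0 x) / (X n - z0) \<partial>M) =
        ((\<integral>x. f (X n) x \<partial>M) - (\<integral>x. f z0 x \<partial>M)) / (X n - z0)" for n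
    proof -
      have "X n \<in> S"
        using X by blast
      then show ?thesis
        by (simp only: integral_divide_zero Bochner_Integration.integral_diff[OF int int[OF S(3)]])
    qed
    ultimately show "(\<lambda>n. ((\<integral>x. f (X n) x \<partial>M) - (\<integral>x. f z0 x \<partial>M)) / (X n - z0))
                 \<longlonglongrightarrow> (\<integral>x. f' z0 x \<partial>M)"
      by (simp only:)
  qed
  then show ?thesis
    unfolding has_field_derivative_iff at_within_open[OF S(3,1)] .
qed

lemma integrable_exp_neg_abs:
  fixes \<delta> :: real
  assumes "\<delta> > 0"
  shows "integrable lborel (\<lambda>v::real. exp (- \<delta> * \<bar>v\<bar>))"
proof -
  have "(\<lambda>v. exp (- \<delta> * v)) integrable_on {0..}"
    using integrable_on_exp_minus_to_infinity[OF assms, of 0] by simp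
  then have "(\<lambda>v. exp (- \<delta> * v)) absolutely_integrable_on {0..}"
    by (subst absolutely_integrable_on_iff_nonneg) auto
  then have 1: "integrable lborel (\<lambda>v. indicator {0..} v *\<^sub>R exp (- \<delta> * v))"
    unfolding set_integrable_def
    by (subst (asm) integrable_completion) auto
  have 2: "integrable lborel (\<lambda>v. indicator {0..} (- v) *\<^sub>R exp (- \<delta> * (- v)))"
    using lborel_integrable_real_affine[OF 1, of "-1" 0] by simp
  show ?thesis
    by (rule Bochner_Integration.integrable_bound[OF Bochner_Integration.integrable_add[OF 1 2]])
       (auto simp: indicator_def)
qed

text \<open>
  All integrands over the real line below decay at least exponentially on both sides; this is the
  criterion used for their integrability.
\<close>

lemma integrable_of_exp_decay:
  fixes f :: "real \<Rightarrow> 'a::{banach, second_countable_topology}"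
  assumes "\<delta> > 0" "f \<in> borel_measurable lborel" "\<And>v. norm (f v) \<le> C * exp (- \<delta> * \<bar>v\<bar>)"
  shows "integrable lborel f"
proof (rule Bochner_Integration.integrable_bound)
  show "integrable lborel (\<lambda>v. C * exp (- \<delta> * \<bar>v\<bar>))"
    by (intro integrable_mult_right integrable_exp_neg_abs assms(1))
  show "AE v in lborel. norm (f v) \<le> norm (C * exp (- \<delta> * \<bar>v\<bar>))"
    by (intro AE_I2 order.trans[OF assms(3)]) (simp add: abs_mult mult_right_mono)
qed (fact assms(2))

lemma norm_powr_of_real:
  assumes "x > 0"
  shows "norm (of_real x powr (a :: complex)) = x powr Re a"
  using assms by (subst norm_powr_real_powr) auto

section \<open>Laplace integrals of powers\<close>

text \<open>
  Only the case \<open>p = 1\<close> needs Euler's integral for the Gamma function; the substitution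
  \<open>t \<mapsto> p t\<close> does the rest.
\<close>

lemma Laplace_powr:
  fixes a :: complex and p :: real
  assumes a: "Re a > 0" and p: "p > 0"
  shows "set_integrable lborel {0<..} (\<lambda>t. of_real t powr (a - 1) * of_real (exp (- t * p)))" (is ?A)
    and "(LBINT t:{0<..}. of_real t powr (a - 1) * of_real (exp (- t * p))) =
           Gamma a * of_real p powr (- a)" (is ?B)
proof -
  have eq: "of_real t powr (a - 1) * of_real (exp (- t * p)) =
              of_real t powr (a - 1) / of_real (exp (p * t))" for t p
    by (simp add: exp_minus field_simps)
  have int: "set_integrable lborel {0<..} (\<lambda>t. of_real t powr (a - 1) * of_real (exp (- t * p)))"
    if p: "p > 0" for p :: real
  proof -
    have "(\<lambda>t. complex_of_real t powr (a - 1) * of_real (exp (- t * p))) absolutely_integrable_on {0<..}"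
      unfolding eq by (rule absolutely_integrable_Gamma_integral[OF a p])
    moreover have "(\<lambda>t. indicator {0<..} t *\<^sub>R (complex_of_real t powr (a - 1) * of_real (exp (- t * p))))
        \<in> borel_measurable borel"
      by (intro borel_measurable_continuous_on_indicator)
         (auto intro!: continuous_intros)
    ultimately show ?thesis
      unfolding set_integrable_def by (subst (asm) integrable_completion) auto
  qed
  show ?A
    by (rule int[OF p])
  have 1: "(LBINT t:{0<..}. of_real t powr (a - 1) * of_real (exp (- t * 1))) = Gamma a"
    using set_borel_integral_eq_integral(2)[OF int[of 1]] integral_unique[OF Gamma_integral_complex'[OF a]]
    unfolding eq by simp
  have sc: "indicator {0<..} (0 + p * t) *\<^sub>R
               (of_real (0 + p * t) powr (a - 1) * of_real (exp (- (0 + p * t) * 1))) =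
             of_real p powr (a - 1) *
               (indicator {0<..} t *\<^sub>R (of_real t powr (a - 1) * complex_of_real (exp (- t * p))))" for t
    using p by (auto simp: indicator_def zero_less_mult_iff powr_times_real mult_ac exp_minus)
  have "Gamma a = of_real p * of_real p powr (a - 1) *
            (LBINT t:{0<..}. of_real t powr (a - 1) * of_real (exp (- t * p)))"
    unfolding 1[symmetric] set_lebesgue_integral_def
    by (subst lborel_integral_real_affine[of p _ 0])
       (use p in \<open>simp_all only: sc, simp_all add: scaleR_conv_of_real mult.assoc\<close>)
  also have "of_real p * of_real p powr (a - 1) = of_real p powr a"
    using p by (simp add: powr_diff)
  finally show ?B
    using p by (simp add: powr_minus field_simps)
qed

lemma Laplace_powr_norm:
  assumes a: "Re a > 0" and p: "p > 0"
  shows "(\<integral>t. norm (indicator {0<..} t *\<^sub>R (of_real t powr (a - 1) * complex_of_real (exp (- t * p)))) \<partial>lborel) =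
           Gamma (Re a) * p powr (- Re a)"
proof -
  have "complex_of_real (norm (indicator {0<..} t *\<^sub>R (of_real t powr (a - 1) * complex_of_real (exp (- t * p))))) =
          indicator {0<..} t *\<^sub>R (of_real t powr (of_real (Re a) - 1) * complex_of_real (exp (- t * p)))" for t
  proof (cases "t > 0")
    case True
    have "complex_of_real t powr (of_real (Re a) - 1) = of_real (t powr (Re a - 1))"
      using True powr_of_real[of t "Re a - 1"] by simp
    then show ?thesis
      using True by (simp add: norm_mult norm_powr_of_real)
  qed simp
  then have "complex_of_real (\<integral>t. norm (indicator {0<..} t *\<^sub>R (of_real t powr (a - 1) * complex_of_real (exp (- t * p)))) \<partial>lborel) =
      (LBINT t:{0<..}. of_real t powr (of_real (Re a) - 1) * complex_of_real (exp (- t * p)))"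
    unfolding set_lebesgue_integral_def integral_complex_of_real[symmetric] by (simp only:)
  also have "\<dots> = Gamma (complex_of_real (Re a)) * of_real p powr (- of_real (Re a))"
    using a p by (intro Laplace_powr) auto
  also have "\<dots> = complex_of_real (Gamma (Re a) * p powr (- Re a))"
    using p powr_of_real[of p "- Re a"] by (simp add: Gamma_complex_of_real)
  finally show ?thesis
    unfolding of_real_eq_iff .
qed

lemma borel_measurable_lborel_pair_indicator:
  fixes f :: "real \<times> real \<Rightarrow> complex"
  assumes "continuous_on (UNIV \<times> {0<..}) f"
  shows "(\<lambda>(v, t). indicator {0<..} t *\<^sub>R f (v, t)) \<in> borel_measurable (lborel \<Otimes>\<^sub>M lborel)"
proof -
  have "(\<lambda>x. indicator (UNIV \<times> {0<..}) x *\<^sub>R f x) \<in> borel_measurable borel"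
    by (intro borel_measurable_continuous_on_indicator assms) (auto intro!: borel_Times)
  moreover have "(\<lambda>x. indicator (UNIV \<times> {0<..}) x *\<^sub>R f x) = (\<lambda>(v, t). indicator {0<..} t *\<^sub>R f (v, t))"
    by (auto simp: indicator_def fun_eq_iff)
  ultimately show ?thesis
    by (simp add: lborel_prod)
qed

text \<open>
  The integral over \<open>t\<close> of the norms is a Gamma integral as well, so absolute integrability of
  the double integral reduces to the hypothesis \<open>int\<close>.
\<close>

lemma Laplace_powr_Fubini:
  fixes p :: "real \<Rightarrow> real" and q :: "real \<Rightarrow> complex" and a :: complex
  assumes a: "Re a > 0" and p: "\<And>v. p v > 0" "continuous_on UNIV p" and q: "continuous_on UNIV q"
    and int: "integrable lborel (\<lambda>v. norm (q v) * p v powr (- Re a))"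
  shows "set_integrable lborel {0<..}
           (\<lambda>t. of_real t powr (a - 1) * (\<integral>v. of_real (exp (- t * p v)) * q v \<partial>lborel))" (is ?A)
    and "(LBINT t:{0<..}. of_real t powr (a - 1) * (\<integral>v. of_real (exp (- t * p v)) * q v \<partial>lborel)) =
           Gamma a * (\<integral>v. q v * of_real (p v) powr (- a) \<partial>lborel)" (is ?B)
proof -
  define F :: "real \<Rightarrow> real \<Rightarrow> complex" where
    "F v t = indicator {0<..} t *\<^sub>R (of_real t powr (a - 1) * of_real (exp (- t * p v)) * q v)" for v t
  have Fv: "F v t = q v * (indicator {0<..} t *\<^sub>R (of_real t powr (a - 1) * of_real (exp (- t * p v))))" for v t
    by (simp add: F_def mult_ac)
  have Ft: "F v t = (indicator {0<..} t *\<^sub>R of_real t powr (a - 1)) * (of_real (exp (- t * p v)) * q v)" for v t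
    by (simp add: F_def mult_ac)
  have cont: "continuous_on (UNIV \<times> {0<..}) 
       (\<lambda>x. of_real (snd x) powr (a - 1) * of_real (exp (- snd x * p (fst x))) * q (fst x))"
    by (auto intro!: continuous_intros continuous_on_compose2[OF p(2)] continuous_on_compose2[OF q])
  have meas: "case_prod F \<in> borel_measurable (lborel \<Otimes>\<^sub>M lborel)"
    using borel_measurable_lborel_pair_indicator[OF cont] unfolding F_def[abs_def] by simp
  have intF: "integrable lborel (F v)" for v
    using Laplace_powr(1)[OF a p(1)[of v]]
    unfolding Fv set_integrable_def by (rule integrable_mult_right)
  have "(\<integral>t. norm (F v t) \<partial>lborel) = Gamma (Re a) * (norm (q v) * p v powr (- Re a))" for v
    unfolding Fv norm_mult integral_mult_right_zero Laplace_powr_norm[OF a p(1)] by simp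
  then have integ: "integrable (lborel \<Otimes>\<^sub>M lborel) (case_prod F)"
    using meas int intF by (intro lborel_pair.Fubini_integrable) auto
  have inner: "(\<integral>v. F v t \<partial>lborel) =
      indicator {0<..} t *\<^sub>R (of_real t powr (a - 1) * (\<integral>v. of_real (exp (- t * p v)) * q v \<partial>lborel))" for t
    unfolding Ft by simp
  show ?A
    using lborel_pair.integrable_snd[OF integ] unfolding set_integrable_def inner .
  have "(\<integral>t. (\<integral>v. F v t \<partial>lborel) \<partial>lborel) = (\<integral>v. (\<integral>t. F v t \<partial>lborel) \<partial>lborel)"
    by (rule lborel_pair.Fubini_integral[OF integ])
  also have "\<dots> = (\<integral>v. Gamma a * (q v * of_real (p v) powr (- a)) \<partial>lborel)"
    unfolding Fv integral_mult_right_zero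
    by (subst Laplace_powr(2)[OF a p(1), unfolded set_lebesgue_integral_def]) (simp only: mult_ac integral_mult_right_zero)
  finally show ?B
    unfolding set_lebesgue_integral_def inner by simp
qed

lemma square_half_le_exp: "v\<^sup>2 / 2 \<le> exp (v::real)" if "v \<ge> 0"
  using exp_lower_Taylor_quadratic[OF that] that by simp

lemma linear_minus_square_le: "b * v - t * (v\<^sup>2 / 2) \<le> b\<^sup>2 / (2 * t)" if "t > 0" for b v t :: real
proof -
  have "0 \<le> (b - t * v)\<^sup>2 / (2 * t)"
    using that by simp
  also have "\<dots> = b\<^sup>2 / (2 * t) - (b * v - t * (v\<^sup>2 / 2))"
    using that by (simp add: power2_diff field_simps power2_eq_square)
  finally show ?thesis by simp
qed

text \<open>
  For \<open>v \<ge> 0\<close> the quadratic lower bound for \<open>exp v\<close> beats any linear term, after completing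
  the square; for \<open>v \<le> 0\<close> the factor \<open>exp (a v)\<close> decays by itself.
\<close>

lemma integrable_exp_linear_minus_exp:
  fixes a :: complex and t :: real
  assumes a: "Re a > 0" and t: "t > 0"
  shows "integrable lborel (\<lambda>v. exp (a * of_real v - of_real (t * exp v)))"
proof (rule integrable_of_exp_decay[where \<delta> = "min 1 (Re a)" and C = "exp ((Re a + 1)\<^sup>2 / (2 * t))"])
  show "min 1 (Re a) > 0"
    using a by simp
  show "(\<lambda>v. exp (a * of_real v - of_real (t * exp v))) \<in> borel_measurable lborel"
    by (auto intro!: borel_measurable_continuous_onI continuous_intros)
  fix v :: real
  have "Re a * v - t * exp v \<le> (Re a + 1)\<^sup>2 / (2 * t) - min 1 (Re a) * \<bar>v\<bar>"
  proof (cases "v \<ge> 0")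
    case True
    have "t * (v\<^sup>2 / 2) \<le> t * exp v"
      using square_half_le_exp[OF True] t by (intro mult_left_mono) auto
    moreover have "(Re a + 1) * v - t * (v\<^sup>2 / 2) \<le> (Re a + 1)\<^sup>2 / (2 * t)"
      by (rule linear_minus_square_le[OF t])
    moreover have "min 1 (Re a) * v \<le> 1 * v"
      using True by (intro mult_right_mono) auto
    ultimately show ?thesis
      using True by (simp add: algebra_simps)
  next
    case False
    have "min 1 (Re a) * (- v) \<le> Re a * (- v)"
      using False by (intro mult_right_mono) auto
    moreover have "0 \<le> (Re a + 1)\<^sup>2 / (2 * t)" "0 \<le> t * exp v" "\<bar>v\<bar> = - v"
      using t False by auto
    ultimately show ?thesis
      by simp
  qed
  then show "norm (exp (a * of_real v - of_real (t * exp v)))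
       \<le> exp ((Re a + 1)\<^sup>2 / (2 * t)) * exp (- min 1 (Re a) * \<bar>v\<bar>)"
    by (simp flip: exp_add)
qed

text \<open>
  Euler's integral in the variable \<open>ln u\<close>. The translation \<open>v \<mapsto> v + ln t\<close> reduces the
  claim to \<open>t = 1\<close>.
\<close>

lemma integral_exp_linear_minus_exp:
  fixes a :: complex and t :: real
  assumes a: "Re a > 0" and t: "t > 0"
  shows "(\<integral>v. exp (a * of_real v - of_real (t * exp v)) \<partial>lborel) = Gamma a * of_real t powr (- a)"
proof -
  have 1: "(\<integral>v. exp (a * of_real v - of_real (exp v)) \<partial>lborel) = Gamma a"
  proof -
    define f :: "real \<Rightarrow> complex" where "f u = of_real u powr (a - 1) * of_real (exp (- u * 1))" for u
    have e: "exp v *\<^sub>R f (exp v) = exp (a * of_real v - of_real (exp v))" for v :: real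
      by (simp add: f_def powr_def exp_diff exp_minus scaleR_conv_of_real algebra_simps divide_inverse
               exp_of_real[symmetric] Ln_of_real del: exp_of_real)
    have "(LBINT u=0..\<infinity>. f u) = (LBINT v=-\<infinity>..\<infinity>. exp v *\<^sub>R f (exp v))"
    proof (rule interval_integral_substitution_integrable)
      show "set_integrable lborel (einterval (- \<infinity>) \<infinity>) (\<lambda>v. exp v *\<^sub>R f (exp v))"
        unfolding e set_integrable_def using integrable_exp_linear_minus_exp[OF a, of 1]
        by (simp add: einterval_def)
      have "einterval 0 \<infinity> = {0<..}"
        by (auto simp: einterval_def zero_ereal_def)
      then show "set_integrable lborel (einterval 0 \<infinity>) f"
        using Laplace_powr(1)[OF a, of 1] by (simp add: f_def[abs_def])
      show "((ereal \<circ> exp \<circ> real_of_ereal) \<longlongrightarrow> 0) (at_right (- \<infinity>))"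
        unfolding zero_ereal_def ereal_tendsto_simps by (rule exp_at_bot)
      show "((ereal \<circ> exp \<circ> real_of_ereal) \<longlongrightarrow> \<infinity>) (at_left \<infinity>)"
        unfolding ereal_tendsto_simps by (rule exp_at_top)
      show "isCont f (exp x)" for x
        unfolding f_def by (intro continuous_intros) auto
    qed (auto intro!: derivative_eq_intros)
    then show ?thesis
      using Laplace_powr(2)[OF a, of 1]
      unfolding e by (simp add: interval_lebesgue_integral_def einterval_def set_lebesgue_integral_def f_def[abs_def] zero_ereal_def greaterThan_def)
  qed
  have "Gamma a = (\<integral>v. exp (a * of_real (ln t + 1 * v) - of_real (exp (ln t + 1 * v))) \<partial>lborel)"
    unfolding 1[symmetric] by (subst lborel_integral_real_affine[of 1 _ "ln t"]) auto
  also have "\<dots> = (\<integral>v. of_real t powr a * exp (a * of_real v - of_real (t * exp v)) \<partial>lborel)"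
    using t by (intro Bochner_Integration.integral_cong)
      (auto simp: exp_add powr_def exp_diff algebra_simps Ln_of_real)
  finally show ?thesis
    using t by (simp add: powr_minus field_simps)
qed

section \<open>The integral representing MacDonald's function\<close>

text \<open>
  With the integration variable running over the whole line, symmetry in \<open>\<mu>\<close> is the reflection
  \<open>v \<mapsto> - v\<close>, and shifts of \<open>\<mu>\<close> are multiplications by \<open>exp (\<plusminus> v)\<close>.
\<close>

definition K_kernel :: "complex \<Rightarrow> complex \<Rightarrow> real \<Rightarrow> complex" where
  "K_kernel \<mu> z v = exp (- z * of_real (cosh v) - \<mu> * of_real v)"

definition K_integral :: "complex \<Rightarrow> complex \<Rightarrow> complex" where
  "K_integral \<mu> z = (\<integral>v. K_kernel \<mu> z v \<partial>lborel) / 2"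

lemma continuous_on_K_kernel: "continuous_on UNIV (K_kernel \<mu> z)"
  unfolding K_kernel_def by (intro continuous_intros)

lemma borel_measurable_K_kernel [measurable]: "K_kernel \<mu> z \<in> borel_measurable borel"
  by (rule borel_measurable_continuous_onI[OF continuous_on_K_kernel])

lemma K_kernel_shift:
  "K_kernel (\<mu> + 1) z v = exp (- of_real v) * K_kernel \<mu> z v"
  "K_kernel (\<mu> - 1) z v = exp (of_real v) * K_kernel \<mu> z v"
  unfolding K_kernel_def exp_add[symmetric]
  by (rule arg_cong[where f = exp], simp add: algebra_simps)+

lemma exp_abs_le_cosh: "exp \<bar>v\<bar> / 2 \<le> cosh (v :: real)"
  by (cases "v \<ge> 0") (auto simp: cosh_def)

text \<open>
  The bound depends on \<open>z\<close> and \<open>\<mu>\<close> only through a lower bound for \<open>Re z\<close> and an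
  upper bound for \<open>|Re \<mu>|\<close>, as needed for differentiation in either variable.
\<close>

lemma norm_K_kernel_le:
  assumes r: "0 < r" "r \<le> Re z" and b: "\<bar>Re \<mu>\<bar> \<le> b"
  shows "norm (K_kernel \<mu> z v) \<le> exp ((b + 1)\<^sup>2 / r) * exp (- 1 * \<bar>v\<bar>)"
proof -
  have "r / 2 * (\<bar>v\<bar>\<^sup>2 / 2) \<le> r / 2 * exp \<bar>v\<bar>"
    using square_half_le_exp[of "\<bar>v\<bar>"] r by (intro mult_left_mono) auto
  also have "\<dots> \<le> r * cosh v"
    using mult_left_mono[OF exp_abs_le_cosh[of v], of r] r by simp
  also have "\<dots> \<le> Re z * cosh v"
    using r by (intro mult_right_mono) auto
  finally have "r / 2 * (\<bar>v\<bar>\<^sup>2 / 2) \<le> Re z * cosh v" .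
  moreover have "(b + 1) * \<bar>v\<bar> - r / 2 * (\<bar>v\<bar>\<^sup>2 / 2) \<le> (b + 1)\<^sup>2 / r"
    using linear_minus_square_le[of "r / 2" "b + 1" "\<bar>v\<bar>"] r by simp
  moreover have "\<bar>Re \<mu> * v\<bar> \<le> b * \<bar>v\<bar>"
    using b by (simp add: abs_mult mult_right_mono)
  moreover have "(b + 1) * \<bar>v\<bar> = b * \<bar>v\<bar> + \<bar>v\<bar>"
    by (simp add: algebra_simps)
  ultimately have "- Re z * cosh v - Re \<mu> * v \<le> (b + 1)\<^sup>2 / r - \<bar>v\<bar>"
    by linarith
  then show ?thesis
    unfolding K_kernel_def by (simp flip: exp_add)
qed

lemma integrable_K_kernel: "Re z > 0 \<Longrightarrow> integrable lborel (K_kernel \<mu> z)"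
  by (rule integrable_of_exp_decay[where \<delta> = 1, OF _ _ norm_K_kernel_le[of "Re z"]]) auto

text \<open>
  Differentiation brings down the factor \<open>- cosh v\<close>, the mean of two shifts of the order.
\<close>

lemma has_field_derivative_K_integral:
  assumes z: "Re z > 0"
  shows "(K_integral \<mu> has_field_derivative
            - (K_integral (\<mu> - 1) z + K_integral (\<mu> + 1) z) / 2) (at z)"
proof -
  \<comment> \<open>The order is shifted by one in the derivative, whence the margin in \<open>b\<close>.\<close>
  define r b where "r = Re z / 2" and "b = \<bar>Re \<mu>\<bar> + 1"
  define g where "g v = exp ((b + 1)\<^sup>2 / r) * exp (- 1 * \<bar>v\<bar>)" for v :: real
  have r: "r > 0"
    using z by (simp add: r_def)
  have "((\<lambda>z. \<integral>v. K_kernel \<mu> z v \<partial>lborel) has_field_derivative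
          (\<integral>v. - (K_kernel (\<mu> - 1) z v + K_kernel (\<mu> + 1) z v) / 2 \<partial>lborel)) (at z)"
  proof (rule has_field_derivative_integral_dominated[where S = "{w. Re w > r}" and g = g])
    show "open {w. Re w > r}" "convex {w. Re w > r}"
      by (simp_all add: open_halfspace_Re_gt convex_halfspace_Re_gt)
    show "z \<in> {w. Re w > r}"
      using z by (simp add: r_def)
    show "integrable lborel (K_kernel \<mu> w)" if "w \<in> {w. Re w > r}" for w
      using that r by (intro integrable_K_kernel) auto
    show "integrable lborel g"
      unfolding g_def[abs_def] by (intro integrable_mult_right integrable_exp_neg_abs) simp
    show "((\<lambda>w. K_kernel \<mu> w v) has_field_derivative
             - (K_kernel (\<mu> - 1) w v + K_kernel (\<mu> + 1) w v) / 2) (at w)" for w v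
    proof -
      have "((\<lambda>w. K_kernel \<mu> w v) has_field_derivative
               - of_real (cosh v) * K_kernel \<mu> w v) (at w)"
        unfolding K_kernel_def by (auto intro!: derivative_eq_intros)
      also have "- of_real (cosh v) * K_kernel \<mu> w v =
                   - (K_kernel (\<mu> - 1) w v + K_kernel (\<mu> + 1) w v) / 2"
        unfolding K_kernel_shift by (simp add: cosh_def field_simps flip: exp_of_real)
      finally show ?thesis .
    qed
    show "(\<lambda>v. - (K_kernel (\<mu> - 1) z v + K_kernel (\<mu> + 1) z v) / 2) \<in> borel_measurable lborel"
      by measurable
    fix w and v :: real
    assume "w \<in> {w. Re w > r}"
    then have "norm (K_kernel (\<mu> - 1) w v) \<le> g v" "norm (K_kernel (\<mu> + 1) w v) \<le> g v"
      unfolding g_def by (intro norm_K_kernel_le r; auto simp: b_def)+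
    then show "norm (- (K_kernel (\<mu> - 1) w v + K_kernel (\<mu> + 1) w v) / 2) \<le> g v"
      using norm_triangle_ineq[of "K_kernel (\<mu> - 1) w v" "K_kernel (\<mu> + 1) w v"]
      unfolding norm_divide norm_minus_cancel norm_numeral by linarith
  qed
  from DERIV_cdivide[OF this, of 2] show ?thesis
    unfolding K_integral_def[abs_def] using z by (simp add: integrable_K_kernel diff_divide_distrib)
qed

text \<open>
  The derivative in \<open>\<mu>\<close> brings down \<open>- v\<close>, and \<open>|v| \<le> exp v + exp (- v)\<close> bounds
  the result by kernels of neighbouring orders.
\<close>

lemma continuous_K_integral_order:
  assumes z: "Re z > 0"
  shows "isCont (\<lambda>\<mu>. K_integral \<mu> z) \<mu>"
proof -
  \<comment> \<open>Orders within distance 1 of \<open>\<mu>\<close>, shifted by one.\<close>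
  define b where "b = \<bar>Re \<mu>\<bar> + 2"
  define g where "g v = 2 * (exp ((b + 1)\<^sup>2 / Re z) * exp (- 1 * \<bar>v\<bar>))" for v :: real
  have "((\<lambda>\<mu>. \<integral>v. K_kernel \<mu> z v \<partial>lborel) has_field_derivative
          (\<integral>v. - of_real v * K_kernel \<mu> z v \<partial>lborel)) (at \<mu>)"
  proof (rule has_field_derivative_integral_dominated[where S = "ball \<mu> 1" and g = g])
    show "integrable lborel (K_kernel w z)" for w
      using z by (rule integrable_K_kernel)
    show "integrable lborel g"
      unfolding g_def[abs_def] by (intro integrable_mult_right integrable_exp_neg_abs) simp
    show "((\<lambda>w. K_kernel w z v) has_field_derivative - of_real v * K_kernel w z v) (at w)" for w v
      unfolding K_kernel_def by (auto intro!: derivative_eq_intros)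
    show "(\<lambda>v. - of_real v * K_kernel \<mu> z v) \<in> borel_measurable lborel"
      by measurable
    fix w and v :: real
    assume "w \<in> ball \<mu> 1"
    then have "\<bar>Re w - Re \<mu>\<bar> < 1"
      using abs_Re_le_cmod[of "w - \<mu>"] by (simp add: dist_norm norm_minus_commute)
    then have "norm (K_kernel (w - 1) z v) \<le> g v / 2" "norm (K_kernel (w + 1) z v) \<le> g v / 2"
      using z unfolding g_def by (simp_all only: nonzero_mult_div_cancel_left zero_neq_numeral not_False_eq_True)
        (intro norm_K_kernel_le; auto simp: b_def)+
    moreover have "\<bar>v\<bar> \<le> exp v + exp (- v)"
      using exp_ge_add_one_self[of v] exp_ge_add_one_self[of "- v"] exp_gt_zero[of v] exp_gt_zero[of "-v"]
      unfolding abs_le_iff by linarith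
    then have "\<bar>v\<bar> * norm (K_kernel w z v) \<le> (exp v + exp (- v)) * norm (K_kernel w z v)"
      by (intro mult_right_mono) auto
    then have "\<bar>v\<bar> * norm (K_kernel w z v) \<le> norm (K_kernel (w - 1) z v) + norm (K_kernel (w + 1) z v)"
      unfolding K_kernel_shift by (simp add: norm_mult distrib_right)
    ultimately show "norm (- of_real v * K_kernel w z v) \<le> g v"
      by (simp add: norm_mult)
  qed auto
  then have "isCont (\<lambda>\<mu>. \<integral>v. K_kernel \<mu> z v \<partial>lborel) \<mu>"
    by (rule DERIV_isCont)
  then show ?thesis
    unfolding K_integral_def[abs_def] by (intro continuous_intros) auto
qed

lemma K_integral_minus: "K_integral (- \<mu>) z = K_integral \<mu> z"
proof -
  have "(\<integral>v. K_kernel \<mu> z v \<partial>lborel) = (\<integral>v. K_kernel \<mu> z (0 + - 1 * v) \<partial>lborel)"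
    by (subst lborel_integral_real_affine[of "- 1" _ 0]) auto
  then show ?thesis
    by (simp add: K_integral_def K_kernel_def)
qed

text \<open>
  The difference of the two sides is the integral of the derivative of \<open>K_kernel \<mu> z\<close>, a function
  which vanishes at both ends of the line.
\<close>

lemma K_integral_recurrence:
  assumes z: "Re z > 0"
  shows "z * (K_integral (\<mu> + 1) z - K_integral (\<mu> - 1) z) = 2 * \<mu> * K_integral \<mu> z"
proof -
  define f where "f v = z / 2 * (K_kernel (\<mu> + 1) z v - K_kernel (\<mu> - 1) z v) - \<mu> * K_kernel \<mu> z v" for v
  have int: "integrable lborel f"
    unfolding f_def[abs_def] using z
    by (intro Bochner_Integration.integrable_diff integrable_mult_right integrable_K_kernel)
  have cosh_real: "cosh (complex_of_real v) = of_real (cosh v)" for v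
    by (simp add: cosh_def scaleR_conv_of_real flip: exp_of_real)
  have deriv: "(K_kernel \<mu> z has_vector_derivative f v) (at v)" for v
  proof -
    have "((\<lambda>w. exp (- z * cosh w - \<mu> * w)) has_field_derivative
              (- z * sinh (of_real v) - \<mu>) * exp (- z * cosh (of_real v) - \<mu> * of_real v)) (at (of_real v))"
      by (auto intro!: derivative_eq_intros)
    from has_vector_derivative_real_field[OF this]
    have "(K_kernel \<mu> z has_vector_derivative
             (- z * sinh (of_real v) - \<mu>) * exp (- z * cosh (of_real v) - \<mu> * of_real v)) (at v)"
      unfolding K_kernel_def[abs_def] by (simp only: cosh_real)
    also have "(- z * sinh (of_real v) - \<mu>) * exp (- z * cosh (of_real v) - \<mu> * of_real v) = f v"
      unfolding f_def K_kernel_shift unfolding K_kernel_def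
      by (simp add: cosh_real) (simp add: sinh_def scaleR_conv_of_real field_simps)
    finally show ?thesis .
  qed
  have lim: "(K_kernel \<mu> z \<longlongrightarrow> 0) F" if "F \<le> at_infinity" for F
  proof (rule Lim_null_comparison)
    show "\<forall>\<^sub>F v in F. norm (K_kernel \<mu> z v) \<le> exp ((\<bar>Re \<mu>\<bar> + 1)\<^sup>2 / Re z) * exp (- 1 * \<bar>v\<bar>)"
      using norm_K_kernel_le[OF z order.refl order.refl] by (intro always_eventually) blast
    have "((\<lambda>x. exp (- x)) \<longlongrightarrow> (0::real)) at_top"
      using exp_at_bot filterlim_uminus_at_bot_at_top by (rule filterlim_compose)
    from filterlim_compose[OF this filterlim_mono[OF filterlim_norm_at_top order.refl that]]
    have "((\<lambda>v. exp (- \<bar>v\<bar>)) \<longlongrightarrow> 0) F"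
      by simp
    from tendsto_mult_left[OF this]
    show "((\<lambda>v. exp ((\<bar>Re \<mu>\<bar> + 1)\<^sup>2 / Re z) * exp (- 1 * \<bar>v\<bar>)) \<longlongrightarrow> 0) F"
      by simp
  qed
  have "(LBINT v=-\<infinity>..\<infinity>. f v) = 0 - 0"
  proof (rule interval_integral_FTC_integrable)
    show "(K_kernel \<mu> z has_vector_derivative f v) (at v)" for v
      by (rule deriv)
    show "isCont f v" for v
      unfolding f_def by (intro continuous_intros continuous_on_interior[OF continuous_on_K_kernel]) auto
    show "set_integrable lborel (einterval (- \<infinity>) \<infinity>) f"
      using int by (simp add: set_integrable_def)
    show "((K_kernel \<mu> z \<circ> real_of_ereal) \<longlongrightarrow> 0) (at_right (- \<infinity>))"
      unfolding ereal_tendsto_simps by (intro lim at_bot_le_at_infinity) 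
    show "((K_kernel \<mu> z \<circ> real_of_ereal) \<longlongrightarrow> 0) (at_left \<infinity>)"
      unfolding ereal_tendsto_simps by (intro lim at_top_le_at_infinity)
  qed auto
  then have "(\<integral>v. f v \<partial>lborel) = 0"
    by (simp add: interval_lebesgue_integral_def set_lebesgue_integral_def)
  then show ?thesis
    unfolding f_def using z
    by (simp add: integrable_K_kernel K_integral_def field_simps)
qed

text \<open>
  The translation \<open>v \<mapsto> v - ln x\<close> absorbs the factor \<open>x powr a\<close> and turns the exponent
  \<open>x cosh v\<close> into \<open>(exp v + x\<^sup>2 exp (- v)) / 2\<close>, which decreases to \<open>exp v / 2\<close>; the limit
  is then a Gamma integral.
\<close>

lemma K_integral_small_argument:
  assumes a: "Re a > 0"
  shows "((\<lambda>x. of_real x powr a * K_integral a (of_real x)) \<longlongrightarrow> 2 powr (a - 1) * Gamma a) (at_right 0)"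
proof -
  define s where "s x v = exp (a * of_real v - of_real ((exp v + x\<^sup>2 * exp (- v)) / 2))" for x v :: real
  have eq: "of_real x powr a * K_integral a (of_real x) = (\<integral>v. s x v \<partial>lborel) / 2" if x: "x > 0" for x
  proof -
    have "K_integral a (of_real x) = (\<integral>v. K_kernel (- a) (of_real x) v \<partial>lborel) / 2"
      by (subst K_integral_minus[symmetric]) (simp add: K_integral_def)
    also have "(\<integral>v. K_kernel (- a) (of_real x) v \<partial>lborel) =
                 (\<integral>v. K_kernel (- a) (of_real x) (- ln x + 1 * v) \<partial>lborel)"
      by (subst lborel_integral_real_affine[of 1 _ "- ln x"]) auto
    also have "\<dots> = (\<integral>v. of_real x powr (- a) * s x v \<partial>lborel)"
    proof (intro Bochner_Integration.integral_cong refl)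
      fix v :: real
      have "x * cosh (- ln x + 1 * v) = (exp v + x\<^sup>2 * exp (- v)) / 2"
        using x by (simp add: cosh_def exp_add exp_diff exp_minus field_simps power2_eq_square)
      then have "complex_of_real x * of_real (cosh (- ln x + 1 * v)) = of_real ((exp v + x\<^sup>2 * exp (- v)) / 2)"
        by (simp only: of_real_mult[symmetric])
      then have "- of_real x * of_real (cosh (- ln x + 1 * v)) - - a * of_real (- ln x + 1 * v) =
                   - a * of_real (ln x) + (a * of_real v - of_real ((exp v + x\<^sup>2 * exp (- v)) / 2))"
        unfolding mult_minus_left by (simp only:) (simp add: algebra_simps)
      then show "K_kernel (- a) (of_real x) (- ln x + 1 * v) = of_real x powr (- a) * s x v"
        unfolding K_kernel_def s_def using x
        by (simp only: exp_add) (simp add: powr_def Ln_of_real)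
    qed
    finally show ?thesis
      using x by (simp add: powr_minus field_simps)
  qed
  have "((\<lambda>x. \<integral>v. s x v \<partial>lborel) \<longlongrightarrow> (\<integral>v. s 0 v \<partial>lborel)) (at_right 0)"
    unfolding tendsto_at_iff_sequentially comp_def
  proof (intro allI impI)
    fix X :: "nat \<Rightarrow> real"
    assume X: "\<forall>i. X i \<in> {0<..} - {0}" and lim: "X \<longlonglongrightarrow> 0"
    show "(\<lambda>n. \<integral>v. s (X n) v \<partial>lborel) \<longlonglongrightarrow> (\<integral>v. s 0 v \<partial>lborel)"
    proof (rule integral_dominated_convergence[where w = "\<lambda>v. norm (s 0 v)"])
      show "AE v in lborel. (\<lambda>n. s (X n) v) \<longlonglongrightarrow> s 0 v"
        unfolding s_def by (intro AE_I2 tendsto_intros lim) auto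
      show "AE v in lborel. norm (s (X n) v) \<le> norm (s 0 v)" for n
        unfolding s_def by (intro AE_I2) simp
      show "integrable lborel (\<lambda>v. norm (s 0 v))"
        using integrable_exp_linear_minus_exp[OF a, of "1/2"] unfolding s_def
        by (intro integrable_norm) simp
    qed (auto simp: s_def intro!: borel_measurable_continuous_onI continuous_intros)
  qed
  moreover have "(\<integral>v. s 0 v \<partial>lborel) = Gamma a * 2 powr a"
  proof -
    have "(\<integral>v. s 0 v \<partial>lborel) = Gamma a * of_real (1 / 2) powr (- a)"
      unfolding s_def using integral_exp_linear_minus_exp[OF a, of "1/2"] by simp
    also have "of_real (1 / 2) powr (- a) = exp (- a * of_real (ln (1 / 2)))"
      by (subst powr_def, subst Ln_of_real) auto
    also have "\<dots> = 2 powr a"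
      using Ln_of_real[of 2] by (simp add: powr_def ln_div)
    finally show ?thesis .
  qed
  ultimately have "((\<lambda>x. (\<integral>v. s x v \<partial>lborel) / 2) \<longlongrightarrow> Gamma a * 2 powr a / 2) (at_right 0)"
    by (intro tendsto_divide) auto
  also have "Gamma a * 2 powr a / 2 = 2 powr (a - 1) * Gamma a"
    by (simp add: powr_diff)
  finally show ?thesis
    by (rule Lim_transform_eventually)
       (use eq in \<open>auto simp: eventually_at_right_less intro!: eventually_mono[OF eventually_at_right_less]\<close>)
qed

section \<open>Wronskians of modified Bessel functions\<close>

definition bessel_coeff :: "complex \<Rightarrow> nat \<Rightarrow> complex" where
  "bessel_coeff \<mu> k = rGamma (\<mu> + of_nat k + 1) / fact k"

text \<open>
  The function \<open>(z / 2) powr (- \<mu>) * bessel_I \<mu> z\<close> in the variable \<open>w = (z / 2)\<^sup>2\<close>. It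
  is entire in \<open>w\<close>, which is why Wronskians are computed from it.
\<close>

definition bessel_entire :: "complex \<Rightarrow> complex \<Rightarrow> complex" where
  "bessel_entire \<mu> w = (\<Sum>k. bessel_coeff \<mu> k * w ^ k)"

lemma eventually_norm_add_of_nat_ge:
  "\<forall>\<^sub>F n in sequentially. C \<le> norm (z + of_nat n :: complex)"
proof -
  obtain N :: nat where N: "C + norm z \<le> of_nat N"
    using real_arch_simple by blast
  have "C \<le> norm (z + of_nat n)" if "n \<ge> N" for n
    using norm_triangle_ineq4[of "z + of_nat n" z] N that by simp
  then show ?thesis
    unfolding eventually_sequentially by blast
qed

text \<open>
  Stated without division, so that it also covers the case \<open>\<mu> + k + 1 = 0\<close>.
\<close>

lemma bessel_coeff_Suc:
  "(\<mu> + of_nat k + 1) * of_nat (Suc k) * bessel_coeff \<mu> (Suc k) = bessel_coeff \<mu> k"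
proof -
  have shift: "\<mu> + of_nat (Suc k) + 1 = (\<mu> + of_nat k + 1) + 1"
    by simp
  have "bessel_coeff \<mu> (Suc k) = rGamma (\<mu> + of_nat k + 1 + 1) / (of_nat (Suc k) * fact k)"
    unfolding bessel_coeff_def fact_Suc shift by simp
  then have "(\<mu> + of_nat k + 1) * of_nat (Suc k) * bessel_coeff \<mu> (Suc k) =
               (\<mu> + of_nat k + 1) * rGamma (\<mu> + of_nat k + 1 + 1) / fact k"
    by (simp del: of_nat_Suc)
  then show ?thesis
    unfolding rGamma_plus1 by (simp only: bessel_coeff_def)
qed

lemma diffs_bessel_coeff: "diffs (bessel_coeff \<mu>) = bessel_coeff (\<mu> + 1)"
  by (simp add: diffs_def bessel_coeff_def fun_eq_iff del: of_nat_Suc)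
     (simp add: add_ac)

lemma summable_bessel_coeff: "summable (\<lambda>k. bessel_coeff \<mu> k * w ^ k)"
proof -
  have "\<forall>\<^sub>F n in sequentially. 1 \<le> norm (\<mu> + 1 + of_nat n)"
       "\<forall>\<^sub>F n in sequentially. 2 * norm w \<le> norm (1 + of_nat n :: complex)"
    by (rule eventually_norm_add_of_nat_ge)+
  then have "\<forall>\<^sub>F n in sequentially. norm (bessel_coeff \<mu> (Suc n) * w ^ Suc n) \<le>
               1 / 2 * norm (bessel_coeff \<mu> n * w ^ n)"
  proof eventually_elim
    case (elim n)
    have "norm (bessel_coeff \<mu> (Suc n)) * (2 * norm w) \<le>
            norm (bessel_coeff \<mu> (Suc n)) * (norm (\<mu> + 1 + of_nat n) * norm (1 + of_nat n :: complex))"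
      using mult_mono[OF elim] by (intro mult_left_mono) auto
    also have "\<dots> = norm (bessel_coeff \<mu> n)"
      unfolding bessel_coeff_Suc[of \<mu> n, symmetric] by (simp add: norm_mult add_ac mult_ac)
    finally have "norm (bessel_coeff \<mu> (Suc n)) * (2 * norm w) * norm w ^ n
                    \<le> norm (bessel_coeff \<mu> n) * norm w ^ n"
      by (rule mult_right_mono) auto
    then show ?case
      by (simp add: norm_mult norm_power mult_ac)
  qed
  then obtain N where "\<And>n. n \<ge> N \<Longrightarrow> norm (bessel_coeff \<mu> (Suc n) * w ^ Suc n) \<le>
               1 / 2 * norm (bessel_coeff \<mu> n * w ^ n)"
    unfolding eventually_sequentially by blast
  then show ?thesis
    by (intro summable_ratio_test[of "1 / 2"]) auto
qed

lemma has_field_derivative_bessel_entire: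
  "(bessel_entire \<mu> has_field_derivative bessel_entire (\<mu> + 1) w) (at w)"
  unfolding bessel_entire_def[abs_def] diffs_bessel_coeff[symmetric]
  by (rule termdiffs_strong_converges_everywhere) (rule summable_bessel_coeff)

lemma bessel_entire_0: "bessel_entire \<mu> 0 = rGamma (\<mu> + 1)"
  using powser_zero[of "bessel_coeff \<mu>"] by (simp add: bessel_entire_def bessel_coeff_def)

lemma bessel_entire_recurrence:
  "bessel_entire (\<mu> - 1) w = \<mu> * bessel_entire \<mu> w + w * bessel_entire (\<mu> + 1) w"
proof -
  have "(\<lambda>k. bessel_coeff (\<mu> + 1) k * w ^ k) sums bessel_entire (\<mu> + 1) w"
    unfolding bessel_entire_def by (intro summable_sums summable_bessel_coeff)
  from sums_mult[OF this, of w]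
  have "(\<lambda>k. of_nat (Suc k) * bessel_coeff \<mu> (Suc k) * w ^ Suc k) sums (w * bessel_entire (\<mu> + 1) w)"
    unfolding diffs_bessel_coeff[symmetric] by (simp add: diffs_def mult_ac)
  then have "(\<lambda>k. of_nat k * bessel_coeff \<mu> k * w ^ k) sums (w * bessel_entire (\<mu> + 1) w)"
    by (subst (asm) sums_Suc_iff) simp
  moreover have "(\<lambda>k. \<mu> * (bessel_coeff \<mu> k * w ^ k)) sums (\<mu> * bessel_entire \<mu> w)"
    unfolding bessel_entire_def by (intro sums_mult summable_sums summable_bessel_coeff)
  ultimately have "(\<lambda>k. \<mu> * (bessel_coeff \<mu> k * w ^ k) + of_nat k * bessel_coeff \<mu> k * w ^ k) sums
                      (\<mu> * bessel_entire \<mu> w + w * bessel_entire (\<mu> + 1) w)"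
    by (intro sums_add)
  moreover have "\<mu> * (bessel_coeff \<mu> k * w ^ k) + of_nat k * bessel_coeff \<mu> k * w ^ k =
                   bessel_coeff (\<mu> - 1) k * w ^ k" for k
  proof -
    have "\<mu> - 1 + of_nat k + 1 = \<mu> + of_nat k"
      by simp
    then have "bessel_coeff (\<mu> - 1) k = (\<mu> + of_nat k) * bessel_coeff \<mu> k"
      using rGamma_plus1[of "\<mu> + of_nat k"] by (simp add: bessel_coeff_def)
    then show ?thesis
      by (simp add: algebra_simps)
  qed
  ultimately show ?thesis
    unfolding bessel_entire_def by (simp add: sums_iff)
qed

lemma bessel_I_eq:
  assumes "z \<noteq> 0"
  shows "bessel_I \<mu> z = (z / 2) powr \<mu> * bessel_entire \<mu> ((z / 2)\<^sup>2)"
proof -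
  have "(z / 2) powr (\<mu> + 2 * of_nat k) * rGamma (\<mu> + of_nat k + 1) / fact k =
          (z / 2) powr \<mu> * (bessel_coeff \<mu> k * ((z / 2)\<^sup>2) ^ k)" for k
  proof -
    have "(z / 2) powr (2 * of_nat k) = (z / 2) ^ (2 * k)"
      using assms powr_complexpow[of "z / 2" "2 * k"] by simp
    then show ?thesis
      by (simp add: powr_add bessel_coeff_def power_mult)
  qed
  then show ?thesis
    unfolding bessel_I_def bessel_entire_def
    by (simp add: suminf_mult summable_bessel_coeff)
qed

lemma bessel_I_recurrence:
  assumes "z \<noteq> 0"
  shows "z * (bessel_I (\<mu> - 1) z - bessel_I (\<mu> + 1) z) = 2 * \<mu> * bessel_I \<mu> z"
proof -
  have "(z / 2) powr (\<mu> - 1) = (z / 2) powr \<mu> / (z / 2)" "(z / 2) powr (\<mu> + 1) = (z / 2) powr \<mu> * (z / 2)"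
    using assms by (simp_all add: powr_diff powr_add)
  then show ?thesis
    unfolding bessel_I_eq[OF assms] bessel_entire_recurrence[of \<mu>]
    by (simp only:) (use assms in \<open>simp add: power2_eq_square field_simps\<close>)
qed

lemma has_field_derivative_bessel_I:
  assumes z: "Re z > 0"
  shows "(bessel_I \<mu> has_field_derivative bessel_I (\<mu> + 1) z + \<mu> / z * bessel_I \<mu> z) (at z)"
proof -
  have nz: "z \<noteq> 0" "z / 2 \<notin> \<real>\<^sub>\<le>\<^sub>0"
    using z by (auto simp: complex_nonpos_Reals_iff)
  have "((\<lambda>z. (z / 2) powr \<mu> * bessel_entire \<mu> ((z / 2)\<^sup>2)) has_field_derivative
           (z / 2) powr \<mu> * (bessel_entire (\<mu> + 1) ((z / 2)\<^sup>2) * (z / 2)) +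
           (\<mu> * (z / 2) powr (\<mu> - 1) / 2) * bessel_entire \<mu> ((z / 2)\<^sup>2)) (at z)"
    using nz by (auto intro!: derivative_eq_intros
        DERIV_chain2[OF has_field_derivative_bessel_entire] simp: power2_eq_square)
  also have "(z / 2) powr \<mu> * (bessel_entire (\<mu> + 1) ((z / 2)\<^sup>2) * (z / 2)) +
               (\<mu> * (z / 2) powr (\<mu> - 1) / 2) * bessel_entire \<mu> ((z / 2)\<^sup>2) =
             bessel_I (\<mu> + 1) z + \<mu> / z * bessel_I \<mu> z"
    using nz by (simp add: bessel_I_eq powr_add powr_diff mult_ac)
  finally show ?thesis
    by (rule has_field_derivative_transform_within_open[where S = "{w. Re w > 0}"])
       (use z in \<open>auto simp: open_halfspace_Re_gt intro!: bessel_I_eq[symmetric]\<close>)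
qed

lemma not_nonpos_Int_if_Re_pos: "Re z > 0 \<Longrightarrow> z \<notin> \<int>\<^sub>\<le>\<^sub>0"
  by (auto elim!: nonpos_Ints_cases)

text \<open>
  \<open>I\<close> and \<open>K\<close> satisfy three-term recurrences which differ only in a sign; the extra terms cancel.
\<close>

lemma bessel_I_K_wronskian_step:
  assumes z: "Re z > 0"
  shows "bessel_I (\<mu> + 1) z * K_integral (\<mu> + 1 + 1) z + bessel_I (\<mu> + 1 + 1) z * K_integral (\<mu> + 1) z =
         bessel_I \<mu> z * K_integral (\<mu> + 1) z + bessel_I (\<mu> + 1) z * K_integral \<mu> z"
proof -
  have nz: "z \<noteq> 0"
    using z by auto
  have "K_integral (\<mu> + 1 + 1) z = K_integral \<mu> z + 2 * (\<mu> + 1) / z * K_integral (\<mu> + 1) z"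
       "bessel_I (\<mu> + 1 + 1) z = bessel_I \<mu> z - 2 * (\<mu> + 1) / z * bessel_I (\<mu> + 1) z"
    using K_integral_recurrence[OF z, of "\<mu> + 1"] bessel_I_recurrence[OF nz, of "\<mu> + 1"] nz
    by (simp_all add: field_simps)
  then show ?thesis
    by (simp only:) (simp add: algebra_simps)
qed

text \<open>
  The differential relations and recurrences make the derivative of the left-hand side vanish. For
  \<open>Re \<mu> > 0\<close> the behaviour of \<open>K\<close> at the origin is known in both orders, and the limit
  along the positive reals is \<open>\<Gamma>(\<mu> + 1) / \<Gamma>(\<mu> + 1)\<close>.
\<close>

lemma bessel_I_K_wronskian_pos:
  assumes \<mu>: "Re \<mu> > 0" and z: "Re z > 0"
  shows "z * (bessel_I \<mu> z * K_integral (\<mu> + 1) z + bessel_I (\<mu> + 1) z * K_integral \<mu> z) = 1"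
proof -
  define U where "U z = z * (bessel_I \<mu> z * K_integral (\<mu> + 1) z + bessel_I (\<mu> + 1) z * K_integral \<mu> z)" for z
  have "(U has_field_derivative 0) (at w)" if w: "Re w > 0" for w
  proof -
    have nz: "w \<noteq> 0"
      using w by auto
    have rec: "bessel_I (\<mu> + 1 + 1) w = bessel_I \<mu> w - 2 * (\<mu> + 1) / w * bessel_I (\<mu> + 1) w"
              "K_integral (\<mu> + 1 + 1) w = K_integral \<mu> w + 2 * (\<mu> + 1) / w * K_integral (\<mu> + 1) w"
              "K_integral (\<mu> - 1) w = K_integral (\<mu> + 1) w - 2 * \<mu> / w * K_integral \<mu> w"
      using bessel_I_recurrence[OF nz, of "\<mu> + 1"] K_integral_recurrence[OF w, of "\<mu> + 1"]
        K_integral_recurrence[OF w, of \<mu>] nz by (simp_all add: field_simps)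
    show ?thesis
      unfolding U_def[abs_def]
      by (rule derivative_eq_intros has_field_derivative_bessel_I has_field_derivative_K_integral w refl)+
         (simp only: rec add_diff_cancel_right', use nz in \<open>simp add: field_simps\<close>)
  qed
  then obtain c where c: "\<And>w. Re w > 0 \<Longrightarrow> U w = c"
    using has_field_derivative_zero_constant[of "{w. Re w > 0}" U]
    by (auto simp: convex_halfspace_Re_gt intro: has_field_derivative_at_within)
  \<comment> \<open>\<open>P\<close> and \<open>E\<close> have limits at the origin, and \<open>U\<close> is expressed through them.\<close>
  define P where "P a x = of_real x powr a * K_integral a (of_real x)" for a :: complex and x :: real
  define E where "E a x = bessel_entire a ((of_real x / 2)\<^sup>2)" for a :: complex and x :: real
  have Elim: "(E a \<longlongrightarrow> rGamma (a + 1)) (at_right 0)" for a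
  proof -
    have "isCont (bessel_entire a) 0"
      by (rule DERIV_isCont[OF has_field_derivative_bessel_entire])
    moreover have "((\<lambda>x. (of_real x / 2 :: complex)\<^sup>2) \<longlongrightarrow> 0) (at_right 0)"
      by (auto intro!: tendsto_eq_intros)
    ultimately show ?thesis
      unfolding E_def bessel_entire_0[symmetric] by (rule isCont_tendsto_compose)
  qed
  have Plim: "(P a \<longlongrightarrow> 2 powr (a - 1) * Gamma a) (at_right 0)" if "Re a > 0" for a
    unfolding P_def by (rule K_integral_small_argument[OF that])
  have Ueq: "U (of_real x) = 2 powr (- \<mu>) * E \<mu> x * P (\<mu> + 1) x +
                (2 powr (- \<mu> - 1) * E (\<mu> + 1) x * P \<mu> x) * (of_real x)\<^sup>2" if x: "x > 0" for x
  proof -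
    have half: "(of_real x / 2) powr a = complex_of_real x powr a * 2 powr (- a)" for a
    proof -
      have "Ln (of_real x / 2) = of_real (ln x) - of_real (ln 2)"
        using x Ln_of_real[of "x / 2"] by (simp add: ln_div)
      then show ?thesis
        using x Ln_of_real[of 2] unfolding powr_def
        by (simp only:) (simp add: Ln_of_real algebra_simps flip: exp_add)
    qed
    show ?thesis
      using x unfolding U_def P_def E_def
      by (simp add: bessel_I_eq half powr_add powr_diff powr_minus field_simps power2_eq_square)
  qed
  have "((\<lambda>x. 2 powr (- \<mu>) * E \<mu> x * P (\<mu> + 1) x +
                (2 powr (- \<mu> - 1) * E (\<mu> + 1) x * P \<mu> x) * (of_real x)\<^sup>2) \<longlongrightarrow>
           2 powr (- \<mu>) * rGamma (\<mu> + 1) * (2 powr (\<mu> + 1 - 1) * Gamma (\<mu> + 1)) +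
           (2 powr (- \<mu> - 1) * rGamma (\<mu> + 1 + 1) * (2 powr (\<mu> - 1) * Gamma \<mu>)) * (of_real 0)\<^sup>2) (at_right 0)"
    using \<mu> by (intro tendsto_intros Elim Plim) auto
  moreover have "\<mu> + 1 \<notin> \<int>\<^sub>\<le>\<^sub>0"
    by (rule not_nonpos_Int_if_Re_pos) (use \<mu> in simp)
  ultimately have "((\<lambda>x. 2 powr (- \<mu>) * E \<mu> x * P (\<mu> + 1) x +
                (2 powr (- \<mu> - 1) * E (\<mu> + 1) x * P \<mu> x) * (of_real x)\<^sup>2) \<longlongrightarrow> 1) (at_right 0)"
    by (simp add: powr_minus rGamma_inverse_Gamma Gamma_eq_zero_iff field_simps)
  then have "((\<lambda>_. c) \<longlongrightarrow> 1) (at_right (0::real))"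
    by (rule Lim_transform_eventually)
       (use Ueq c in \<open>auto intro!: eventually_mono[OF eventually_at_right_less]\<close>)
  then have "c = 1"
    by (simp add: tendsto_const_iff)
  then show ?thesis
    using c[OF z] by (simp add: U_def)
qed

text \<open>
  By \<open>bessel_I_K_wronskian_step\<close> the expression does not change when \<open>\<mu>\<close> is increased by
  \<open>1\<close>, so the order may be assumed to have positive real part.
\<close>

lemma bessel_I_K_wronskian:
  assumes z: "Re z > 0"
  shows "z * (bessel_I \<mu> z * K_integral (\<mu> + 1) z + bessel_I (\<mu> + 1) z * K_integral \<mu> z) = 1"
proof -
  have "z * (bessel_I \<mu> z * K_integral (\<mu> + 1) z + bessel_I (\<mu> + 1) z * K_integral \<mu> z) = 1"
    if "Re \<mu> + of_nat n > 0" for n :: nat and \<mu>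
    using that
  proof (induction n arbitrary: \<mu>)
    case 0
    then show ?case
      using bessel_I_K_wronskian_pos[OF _ z] by simp
  next
    case (Suc n)
    then have "z * (bessel_I (\<mu> + 1) z * K_integral (\<mu> + 1 + 1) z +
                    bessel_I (\<mu> + 1 + 1) z * K_integral (\<mu> + 1) z) = 1"
      by (intro Suc.IH) simp
    then show ?case
      unfolding bessel_I_K_wronskian_step[OF z] .
  qed
  moreover obtain n :: nat where "- Re \<mu> < of_nat n"
    using reals_Archimedean2 by blast
  then have "Re \<mu> + of_nat n > 0"
    by simp
  ultimately show ?thesis
    by blast
qed

text \<open>
  The left-hand side has derivative \<open>0\<close>, and its value at \<open>0\<close> is given by the reflection formula.
\<close>

lemma bessel_entire_wronskian:
  "bessel_entire (- \<mu> - 1) w * bessel_entire \<mu> w - w * bessel_entire (\<mu> + 1) w * bessel_entire (- \<mu>) w =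
     - sin (of_real pi * \<mu>) / of_real pi"
proof -
  define V where "V w = - \<mu> * bessel_entire (- \<mu>) w * bessel_entire \<mu> w +
      w * (bessel_entire (- \<mu> + 1) w * bessel_entire \<mu> w - bessel_entire (\<mu> + 1) w * bessel_entire (- \<mu>) w)" for w
  have Veq: "bessel_entire (- \<mu> - 1) w * bessel_entire \<mu> w - w * bessel_entire (\<mu> + 1) w * bessel_entire (- \<mu>) w = V w" for w
    unfolding V_def bessel_entire_recurrence[of "- \<mu>"] by (simp add: algebra_simps)
  have "(V has_field_derivative 0) (at w)" for w
  proof -
    have rec: "bessel_entire \<mu> w = (\<mu> + 1) * bessel_entire (\<mu> + 1) w + w * bessel_entire (\<mu> + 1 + 1) w"
              "bessel_entire (- \<mu>) w = (- \<mu> + 1) * bessel_entire (- \<mu> + 1) w + w * bessel_entire (- \<mu> + 1 + 1) w"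
      using bessel_entire_recurrence[of "\<mu> + 1" w] bessel_entire_recurrence[of "- \<mu> + 1" w] by simp_all
    show ?thesis
      unfolding V_def[abs_def]
      by (rule derivative_eq_intros has_field_derivative_bessel_entire refl)+
         (simp add: rec algebra_simps)
  qed
  then have "V w = V 0"
    using has_field_derivative_zero_constant[of UNIV V] by auto
  also have "V 0 = rGamma (- \<mu>) * rGamma (1 - (- \<mu>))"
    unfolding Veq[symmetric] by (simp add: bessel_entire_0 add_ac)
  also have "\<dots> = - sin (of_real pi * \<mu>) / of_real pi"
    unfolding rGamma_reflection_complex by simp
  finally show ?thesis
    unfolding Veq .
qed

lemma bessel_I_wronskian:
  assumes "z \<noteq> 0"
  shows "z * (bessel_I (- \<mu> - 1) z * bessel_I \<mu> z - bessel_I (\<mu> + 1) z * bessel_I (- \<mu>) z) =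
           - 2 * sin (of_real pi * \<mu>) / of_real pi"
proof -
  let ?w = "(z / 2)\<^sup>2"
  have "z * (bessel_I (- \<mu> - 1) z * bessel_I \<mu> z - bessel_I (\<mu> + 1) z * bessel_I (- \<mu>) z) =
          2 * (bessel_entire (- \<mu> - 1) ?w * bessel_entire \<mu> ?w - ?w * bessel_entire (\<mu> + 1) ?w * bessel_entire (- \<mu>) ?w)"
    using assms by (simp add: bessel_I_eq powr_diff powr_add powr_minus field_simps power2_eq_square)
  then show ?thesis
    unfolding bessel_entire_wronskian by simp
qed

lemma sin_pi_eq_0_iff: "sin (\<mu> * of_real pi :: complex) = 0 \<longleftrightarrow> \<mu> \<in> \<int>"
  by (auto simp: sin_eq_0 Ints_def)

text \<open>
  The Wronskian relations for \<open>\<mu>\<close> and \<open>- \<mu>\<close> are linear in \<open>k = K_integral \<mu> z\<close> and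
  \<open>k' = K_integral (\<mu> + 1) z\<close>. Eliminating \<open>k'\<close> leaves \<open>k\<close> times the Wronskian of
  \<open>I\<^sub>\<mu>\<close> and \<open>I\<^sub>-\<^sub>\<mu>\<close>.
\<close>

lemma K_integral_eq_quot:
  assumes z: "Re z > 0" and \<mu>: "\<mu> \<notin> \<int>"
  shows "K_integral \<mu> z = bessel_K_quot z \<mu>"
proof -
  have nz: "z \<noteq> 0"
    using z by auto
  define s where "s = sin (\<mu> * of_real pi)"
  have s: "s \<noteq> 0"
    using \<mu> by (simp add: s_def sin_pi_eq_0_iff)
  define k where "k = K_integral \<mu> z"
  define k' where "k' = K_integral (\<mu> + 1) z"
  have "K_integral (- \<mu> + 1) z = K_integral (\<mu> - 1) z"
    using K_integral_minus[of "\<mu> - 1" z] by simp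
  then have km: "z * K_integral (- \<mu> + 1) z = z * k' - 2 * \<mu> * k"
    using K_integral_recurrence[OF z, of \<mu>] by (simp add: k_def k'_def algebra_simps)
  have 1: "z * (bessel_I \<mu> z * k' + bessel_I (\<mu> + 1) z * k) = 1"
    using bessel_I_K_wronskian[OF z, of \<mu>] by (simp add: k_def k'_def)
  have 2: "bessel_I (- \<mu>) z * (z * k' - 2 * \<mu> * k) + z * bessel_I (- \<mu> + 1) z * k = 1"
    using bessel_I_K_wronskian[OF z, of "- \<mu>"] unfolding km[symmetric]
    by (simp add: k_def K_integral_minus algebra_simps)
  have 3: "z * bessel_I (- \<mu> + 1) z = z * bessel_I (- \<mu> - 1) z + 2 * \<mu> * bessel_I (- \<mu>) z"
    using bessel_I_recurrence[OF nz, of "- \<mu>"] by (simp add: algebra_simps)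
  have 4: "z * (bessel_I (- \<mu> - 1) z * bessel_I \<mu> z - bessel_I (\<mu> + 1) z * bessel_I (- \<mu>) z) * of_real pi = - 2 * s"
    using bessel_I_wronskian[OF nz, of \<mu>] by (simp add: s_def mult.commute)
  have "k * (2 * s) = of_real pi * (bessel_I (- \<mu>) z - bessel_I \<mu> z)"
    using 1 2 3 4 by algebra
  then show ?thesis
    using s by (simp add: bessel_K_quot_def k_def s_def field_simps)
qed

text \<open>
  For integer \<open>\<mu>\<close> the quotient agrees with the integral in a punctured neighbourhood of \<open>\<mu>\<close>,
  and the integral is continuous in the order.
\<close>

lemma bessel_K_eq_integral:
  assumes z: "Re z > 0"
  shows "bessel_K \<mu> z = K_integral \<mu> z"
proof (cases "\<mu> \<in> \<int>")
  case True
  have "\<forall>\<^sub>F w in at \<mu>. w \<notin> \<int>"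
    unfolding eventually_at
  proof (intro exI[of _ 1] conjI ballI impI notI)
    fix w assume w: "w \<noteq> \<mu> \<and> dist w \<mu> < 1" "w \<in> \<int>"
    with True obtain m n where "w = of_int m" "\<mu> = of_int n"
      by (auto elim!: Ints_cases)
    then have "m \<noteq> n" "real_of_int \<bar>m - n\<bar> < 1"
      using w by (auto simp: dist_of_int)
    then show False
      by linarith
  qed auto
  then have "\<forall>\<^sub>F w in at \<mu>. K_integral w z = bessel_K_quot z w"
    by eventually_elim (rule K_integral_eq_quot[OF z])
  moreover have "((\<lambda>w. K_integral w z) \<longlongrightarrow> K_integral \<mu> z) (at \<mu>)"
    using continuous_K_integral_order[OF z] by (simp add: isCont_def)
  ultimately have "(bessel_K_quot z \<longlongrightarrow> K_integral \<mu> z) (at \<mu>)"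
    by (rule Lim_transform_eventually[rotated])
  then show ?thesis
    using True unfolding bessel_K_def by (simp add: tendsto_Lim)
next
  case False
  then show ?thesis
    unfolding bessel_K_def using K_integral_eq_quot[OF z] by simp
qed

section \<open>Hypergeometric series and Euler's transformation\<close>

definition hyp_coeff :: "complex \<Rightarrow> complex \<Rightarrow> complex \<Rightarrow> nat \<Rightarrow> complex" where
  "hyp_coeff a b c n = pochhammer a n * pochhammer b n * rGamma (c + of_nat n) / fact n"

lemma hypergeom_reg_series_eq: "hypergeom_reg_series a b c z = (\<Sum>n. hyp_coeff a b c n * z ^ n)"
  by (simp add: hypergeom_reg_series_def hyp_coeff_def)

lemma hyp_coeff_Suc:
  "of_nat (Suc n) * (c + of_nat n) * hyp_coeff a b c (Suc n) =
     (a + of_nat n) * (b + of_nat n) * hyp_coeff a b c n"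
proof -
  have shift: "c + of_nat (Suc n) = (c + of_nat n) + 1"
    by simp
  have "hyp_coeff a b c (Suc n) = (a + of_nat n) * (b + of_nat n) * (pochhammer a n * pochhammer b n) *
          rGamma (c + of_nat n + 1) / (of_nat (Suc n) * fact n)"
    unfolding hyp_coeff_def fact_Suc shift pochhammer_Suc by (simp add: mult_ac del: of_nat_Suc)
  then have "of_nat (Suc n) * (c + of_nat n) * hyp_coeff a b c (Suc n) =
      (a + of_nat n) * (b + of_nat n) * (pochhammer a n * pochhammer b n) *
         ((c + of_nat n) * rGamma (c + of_nat n + 1)) / fact n"
    by (simp add: mult_ac del: of_nat_Suc)
  then show ?thesis
    unfolding rGamma_plus1 by (simp add: hyp_coeff_def mult_ac del: of_nat_Suc)
qed

lemma hyp_coeff_unique: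
  assumes "f 0 = rGamma c" and "\<And>n. c + of_nat n \<noteq> 0"
    and "\<And>n. of_nat (Suc n) * (c + of_nat n) * f (Suc n) = (a + of_nat n) * (b + of_nat n) * f n"
  shows "f n = hyp_coeff a b c n"
proof (induction n)
  case 0
  then show ?case
    using assms(1) by (simp add: hyp_coeff_def)
next
  case (Suc n)
  have "of_nat (Suc n) * (c + of_nat n) * f (Suc n) =
          of_nat (Suc n) * (c + of_nat n) * hyp_coeff a b c (Suc n)"
    unfolding assms(3) hyp_coeff_Suc Suc.IH ..
  moreover have "of_nat (Suc n) * (c + of_nat n) \<noteq> 0"
    using assms(2)[of n] by (simp del: of_nat_Suc)
  ultimately show ?case
    by (simp only: mult_cancel_left) blast
qed

lemma tendsto_shifted_quotient:
  "(\<lambda>n. (a + of_nat n) / (c + of_nat n :: complex)) \<longlonglongrightarrow> 1"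
proof -
  have "filterlim (\<lambda>n. c + of_nat n :: complex) at_infinity sequentially"
    by (intro tendsto_add_filterlim_at_infinity[OF tendsto_const] tendsto_of_nat)
  then have "(\<lambda>n. 1 + (a - c) / (c + of_nat n)) \<longlonglongrightarrow> 1 + 0"
    by (intro tendsto_add tendsto_const tendsto_divide_0[OF tendsto_const])
  moreover have "\<forall>\<^sub>F n in sequentially. 1 + (a - c) / (c + of_nat n) = (a + of_nat n) / (c + of_nat n)"
    using eventually_norm_add_of_nat_ge[of 1 c]
  proof eventually_elim
    case (elim n)
    then have "c + of_nat n \<noteq> 0"
      by auto
    then show ?case
      by (simp add: field_simps)
  qed
  ultimately show ?thesis
    by (simp add: filterlim_cong[OF refl refl])
qed

text \<open>
  The quotient of successive coefficients tends to \<open>1\<close>. The recurrence determines this quotient for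
  large \<open>n\<close> even where some of the coefficients vanish.
\<close>

lemma summable_norm_hyp_coeff:
  assumes z: "norm z < 1"
  shows "summable (\<lambda>n. norm (hyp_coeff a b c n * z ^ n))"
proof -
  define q where "q = (1 + norm z) / 2"
  have q: "norm z < q" "q < 1"
    using z by (auto simp: q_def)
  have "(\<lambda>n. norm ((a + of_nat n) / (c + of_nat n) * ((b + of_nat n) / (1 + of_nat n))) * norm z)
          \<longlonglongrightarrow> norm (1 * 1 :: complex) * norm z"
    by (intro tendsto_intros tendsto_shifted_quotient)
  then have "\<forall>\<^sub>F n in sequentially.
      norm ((a + of_nat n) / (c + of_nat n) * ((b + of_nat n) / (1 + of_nat n))) * norm z < q"
    using q by (intro order_tendstoD(2)) auto
  moreover have "\<forall>\<^sub>F n in sequentially. 1 \<le> norm (c + of_nat n)"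
    by (rule eventually_norm_add_of_nat_ge)
  ultimately have "\<forall>\<^sub>F n in sequentially. norm (norm (hyp_coeff a b c (Suc n) * z ^ Suc n)) \<le>
      q * norm (norm (hyp_coeff a b c n * z ^ n))"
  proof eventually_elim
    case (elim n)
    have nz: "c + of_nat n \<noteq> 0" "(1 + of_nat n :: complex) \<noteq> 0"
      using elim(2) of_nat_neq_0[of n, where ?'a = complex] by auto
    have "hyp_coeff a b c (Suc n) =
            (a + of_nat n) / (c + of_nat n) * ((b + of_nat n) / (1 + of_nat n)) * hyp_coeff a b c n"
    proof -
      have "(1 + of_nat n) * (c + of_nat n) * hyp_coeff a b c (Suc n) =
              (a + of_nat n) * (b + of_nat n) * hyp_coeff a b c n"
        using hyp_coeff_Suc[of n c a b] by simp
      then show ?thesis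
        using nz by (simp add: divide_simps mult_ac)
    qed
    then have "norm (hyp_coeff a b c (Suc n) * z ^ Suc n) =
        (norm ((a + of_nat n) / (c + of_nat n) * ((b + of_nat n) / (1 + of_nat n))) * norm z) *
          norm (hyp_coeff a b c n * z ^ n)"
      by (simp only: norm_mult norm_power power_Suc mult_ac)
    also have "\<dots> \<le> q * norm (hyp_coeff a b c n * z ^ n)"
      using elim(1) by (intro mult_right_mono) auto
    finally show ?case
      by simp
  qed
  then obtain N where "\<And>n. n \<ge> N \<Longrightarrow> norm (norm (hyp_coeff a b c (Suc n) * z ^ Suc n)) \<le>
      q * norm (norm (hyp_coeff a b c n * z ^ n))"
    unfolding eventually_sequentially by blast
  then show ?thesis
    using q by (intro summable_ratio_test[of q]) auto
qed

text \<open>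
  The hypergeometric differential operator. On formal power series, solutions of the differential
  equation are the sequences which satisfy the recurrence of \<open>hyp_coeff\<close>.
\<close>

definition hyp_operator :: "complex \<Rightarrow> complex \<Rightarrow> complex \<Rightarrow> complex fps \<Rightarrow> complex fps" where
  "hyp_operator a b c Y =
     fps_X * (1 - fps_X) * fps_deriv (fps_deriv Y) +
     (fps_const c - (fps_const a + fps_const b + 1) * fps_X) * fps_deriv Y - fps_const a * fps_const b * Y"

lemma fps_nth_hyp_operator:
  "fps_nth (hyp_operator a b c Y) n =
     of_nat (Suc n) * (c + of_nat n) * fps_nth Y (Suc n) - (a + of_nat n) * (b + of_nat n) * fps_nth Y n"
proof -
  have *: "hyp_operator a b c Y = fps_X * fps_deriv (fps_deriv Y) - fps_X * (fps_X * fps_deriv (fps_deriv Y)) +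
     fps_const c * fps_deriv Y - fps_const (a + b + 1) * (fps_X * fps_deriv Y) - fps_const (a * b) * Y"
    unfolding hyp_operator_def by (simp add: algebra_simps flip: fps_const_add fps_const_mult)
  show ?thesis
  proof (cases n)
    case 0
    then show ?thesis
      unfolding * by simp
  next
    case (Suc m)
    then show ?thesis
      unfolding * by (cases m) (simp_all add: algebra_simps)
  qed
qed

lemma hyp_operator_eq_0_iff:
  "hyp_operator a b c Y = 0 \<longleftrightarrow>
     (\<forall>n. of_nat (Suc n) * (c + of_nat n) * fps_nth Y (Suc n) = (a + of_nat n) * (b + of_nat n) * fps_nth Y n)"
  by (simp add: fps_eq_iff fps_nth_hyp_operator del: of_nat_Suc)

text \<open>
  The hypothesis on \<open>G\<close> says that \<open>G\<close> is a multiple of \<open>(1 - X)\<^sup>(\<^sup>a\<^sup>+\<^sup>b\<^sup>-\<^sup>c\<^sup>)\<close>, the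
  factor in Euler's transformation. Multiplying by \<open>1 - X\<close> clears the denominators which its
  derivatives produce.
\<close>

lemma hyp_operator_mult:
  assumes G: "(1 - fps_X) * fps_deriv G = (fps_const c - fps_const a - fps_const b) * G"
  shows "(1 - fps_X) * hyp_operator (c - a) (c - b) c (Y * G) = (1 - fps_X) * G * hyp_operator a b c Y"
proof -
  define A B C X where "A = fps_const a" and "B = fps_const b" and "C = fps_const c" and "X = (fps_X :: complex fps)"
  define E where "E = C - A - B"
  define Y1 Y2 G1 G2 where "Y1 = fps_deriv Y" and "Y2 = fps_deriv Y1" and "G1 = fps_deriv G" and "G2 = fps_deriv G1"
  have g1: "(1 - X) * G1 = E * G"
    using G by (simp add: X_def E_def A_def B_def C_def G1_def)
  have "fps_deriv ((1 - fps_X) * fps_deriv G) = fps_deriv ((fps_const c - fps_const a - fps_const b) * G)"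
    unfolding G ..
  then have g2: "(1 - X) * G2 = (E + 1) * G1"
    by (simp add: X_def E_def A_def B_def C_def G1_def G2_def algebra_simps)
  have g2': "(1 - X) * (1 - X) * G2 = (E + 1) * E * G"
    using g1 g2 by algebra
  have "(1 - X) * hyp_operator (c - a) (c - b) c (Y * G) =
     (1 - X) * (X * (1 - X) * (Y2 * G + 2 * Y1 * G1 + Y * G2) +
       (C - (2 * C - A - B + 1) * X) * (Y1 * G + Y * G1) - (C - A) * (C - B) * (Y * G))"
    unfolding hyp_operator_def X_def A_def B_def C_def Y1_def Y2_def G1_def G2_def
    by (simp add: algebra_simps del: fps_const_add fps_const_mult flip: fps_const_sub)
  also have "\<dots> = X * (1 - X) * ((1 - X) * Y2 * G + 2 * Y1 * ((1 - X) * G1)) + X * Y * ((1 - X) * (1 - X) * G2) +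
       (C - (2 * C - A - B + 1) * X) * ((1 - X) * Y1 * G + Y * ((1 - X) * G1)) - (1 - X) * (C - A) * (C - B) * (Y * G)"
    by (simp add: algebra_simps)
  also have "\<dots> = (1 - X) * G * (X * (1 - X) * Y2 + (C - (A + B + 1) * X) * Y1 - A * B * Y)"
    unfolding g1 g2' E_def by (simp add: algebra_simps)
  finally show ?thesis
    unfolding hyp_operator_def X_def A_def B_def C_def Y1_def Y2_def by simp
qed

lemma one_minus_powr_sums:
  assumes "norm (z :: complex) < 1"
  shows "(\<lambda>n. pochhammer e n / fact n * z ^ n) sums (1 - z) powr (- e)"
proof -
  have "(\<lambda>n. ((- e) gchoose n) * (- z) ^ n) sums (1 + (- z)) powr (- e)"
    using assms by (intro gen_binomial_complex) simp
  moreover have "((- e) gchoose n) * (- z) ^ n = pochhammer e n / fact n * z ^ n" for n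
  proof -
    have "(- 1) ^ n * (- z) ^ n = z ^ n"
      by (simp flip: power_mult_distrib)
    then show ?thesis
      by (simp add: gbinomial_pochhammer mult.commute mult.left_commute)
  qed
  ultimately show ?thesis
    by simp
qed

text \<open>
  The product of the power series of \<open>(1 - z) powr (a + b - c)\<close> with the series for \<open>(a, b)\<close> solves
  the hypergeometric equation for \<open>(c - a, c - b)\<close>, by \<open>hyp_operator_mult\<close>, and has the right
  constant term; hence its coefficients are the expected ones.
\<close>

lemma Euler_transformation:
  assumes c: "\<And>n::nat. c + of_nat n \<noteq> 0" and z: "norm z < 1"
  shows "hypergeom_reg_series (c - a) (c - b) c z =
           (1 - z) powr (a + b - c) * hypergeom_reg_series a b c z"
proof -
  define e where "e = c - a - b"
  define g where "g n = pochhammer e n / fact n" for n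
  define G where "G = Abs_fps g"
  define Y where "Y = Abs_fps (hyp_coeff a b c)"
  have gSuc: "of_nat (Suc n) * g (Suc n) = (e + of_nat n) * g n" for n
    by (simp add: g_def pochhammer_Suc mult_ac del: of_nat_Suc)
  have "(1 - fps_X) * fps_deriv G = (fps_const c - fps_const a - fps_const b) * G"
  proof (rule fps_ext)
    fix n
    have "fps_nth ((1 - fps_X) * fps_deriv G) n = of_nat (Suc n) * g (Suc n) - of_nat n * g n"
      by (cases n) (simp_all add: G_def left_diff_distrib)
    also have "\<dots> = e * g n"
      unfolding gSuc by (simp add: algebra_simps)
    finally show "fps_nth ((1 - fps_X) * fps_deriv G) n = fps_nth ((fps_const c - fps_const a - fps_const b) * G) n"
      by (simp add: G_def e_def)
  qed
  from hyp_operator_mult[OF this, of Y] have "(1 - fps_X) * hyp_operator (c - a) (c - b) c (Y * G) = 0"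
    using hyp_operator_eq_0_iff[of a b c Y] by (simp add: Y_def hyp_coeff_Suc del: of_nat_Suc)
  moreover have "(1 - fps_X :: complex fps) \<noteq> 0"
    by (metis fps_X_neq_one right_minus_eq)
  ultimately have "hyp_operator (c - a) (c - b) c (Y * G) = 0"
    by simp
  then have coeff: "fps_nth (Y * G) n = hyp_coeff (c - a) (c - b) c n" for n
    unfolding hyp_operator_eq_0_iff using c
    by (intro hyp_coeff_unique) (auto simp: Y_def G_def g_def hyp_coeff_def)
  have sumg: "(\<lambda>n. g n * z ^ n) sums (1 - z) powr (- e)" if "norm z < 1" for z
    unfolding g_def using that by (rule one_minus_powr_sums)
  \<comment> \<open>A point between \<open>z\<close> and the unit circle: convergence there is absolute at \<open>z\<close>.\<close>
  obtain w :: complex where w: "norm z < norm w" "norm w < 1"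
  proof
    show "norm z < norm (of_real ((1 + norm z) / 2) :: complex)" "norm (of_real ((1 + norm z) / 2) :: complex) < 1"
      using z by (simp_all add: norm_divide abs_of_nonneg del: of_real_add)
  qed
  have "summable (\<lambda>n. norm (g n * z ^ n))"
    using powser_insidea[OF sums_summable[OF sumg[OF w(2)]] w(1)] .
  from Cauchy_product_sums[OF summable_norm_hyp_coeff[OF z, of a b c] this]
  have "(\<lambda>n. \<Sum>i\<le>n. (hyp_coeff a b c i * z ^ i) * (g (n - i) * z ^ (n - i))) sums
          (hypergeom_reg_series a b c z * (1 - z) powr (- e))"
    unfolding hypergeom_reg_series_eq using sumg[OF z] by (simp add: sums_iff)
  also have "(\<lambda>n. \<Sum>i\<le>n. (hyp_coeff a b c i * z ^ i) * (g (n - i) * z ^ (n - i))) =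
               (\<lambda>n. hyp_coeff (c - a) (c - b) c n * z ^ n)"
  proof
    fix n
    have "(\<Sum>i\<le>n. (hyp_coeff a b c i * z ^ i) * (g (n - i) * z ^ (n - i))) =
            (\<Sum>i\<le>n. hyp_coeff a b c i * g (n - i) * z ^ n)"
      by (intro sum.cong refl) (simp add: power_add[symmetric] mult_ac flip: power_add)
    also have "\<dots> = fps_nth (Y * G) n * z ^ n"
      by (simp add: fps_mult_nth Y_def G_def sum_distrib_right atLeast0AtMost)
    finally show "(\<Sum>i\<le>n. (hyp_coeff a b c i * z ^ i) * (g (n - i) * z ^ (n - i))) =
        hyp_coeff (c - a) (c - b) c n * z ^ n"
      unfolding coeff .
  qed
  finally show ?thesis
    unfolding hypergeom_reg_series_eq[of "c - a"] by (simp add: sums_iff e_def mult_ac algebra_simps)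
qed

section \<open>An Euler type integral for the hypergeometric function\<close>

lemma continuous_on_powr_slit:
  fixes f :: "'a::topological_space \<Rightarrow> complex"
  assumes "continuous_on S f" "\<And>x. x \<in> S \<Longrightarrow> f x \<notin> \<real>\<^sub>\<le>\<^sub>0"
  shows "continuous_on S (\<lambda>x. f x powr a)"
proof -
  have "f x powr a = exp (a * Ln (f x))" if "x \<in> S" for x
    using assms(2)[OF that] by (auto simp: powr_def)
  moreover have "continuous_on S (\<lambda>x. exp (a * Ln (f x)))"
    using assms by (intro continuous_intros) auto
  ultimately show ?thesis
    by (simp cong: continuous_on_cong)
qed

lemma integrable_exp_powr:
  fixes p :: "real \<Rightarrow> real"
  assumes \<kappa>: "\<kappa> > 0" and p: "\<And>v. \<kappa> * exp \<bar>v\<bar> \<le> p v" "continuous_on UNIV p" and \<rho>: "\<bar>Re \<mu>\<bar> < \<rho>"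
  shows "integrable lborel (\<lambda>v. norm (exp (- \<mu> * of_real v)) * p v powr (- \<rho>))"
proof (rule integrable_of_exp_decay[where \<delta> = "\<rho> - \<bar>Re \<mu>\<bar>" and C = "\<kappa> powr (- \<rho>)"])
  have pos: "p v > 0" for v
    using p(1)[of v] \<kappa> by (smt (verit) exp_gt_zero mult_pos_pos)
  then have "p v \<noteq> 0" for v
    by (metis less_irrefl)
  then show "(\<lambda>v. norm (exp (- \<mu> * of_real v)) * p v powr (- \<rho>)) \<in> borel_measurable lborel"
    unfolding measurable_lborel2
    by (intro borel_measurable_continuous_onI continuous_intros p(2)) auto
  show "\<rho> - \<bar>Re \<mu>\<bar> > 0"
    using \<rho> by simp
  fix v :: real
  have "- (Re \<mu> * v) \<le> \<bar>Re \<mu>\<bar> * \<bar>v\<bar>"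
    by (metis abs_ge_minus_self abs_mult)
  then have "norm (exp (- \<mu> * of_real v)) \<le> exp (\<bar>Re \<mu>\<bar> * \<bar>v\<bar>)"
    by simp
  moreover have "p v powr (- \<rho>) \<le> (\<kappa> * exp \<bar>v\<bar>) powr (- \<rho>)"
    using p(1)[of v] \<kappa> \<rho> by (intro powr_mono2') auto
  moreover have "(\<kappa> * exp \<bar>v\<bar>) powr (- \<rho>) = \<kappa> powr (- \<rho>) * exp (- \<rho> * \<bar>v\<bar>)"
    using \<kappa> by (simp add: powr_mult) (simp add: powr_def)
  ultimately have "norm (exp (- \<mu> * of_real v)) * p v powr (- \<rho>) \<le>
      exp (\<bar>Re \<mu>\<bar> * \<bar>v\<bar>) * (\<kappa> powr (- \<rho>) * exp (- \<rho> * \<bar>v\<bar>))"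
    by (metis mult_mono exp_ge_zero powr_ge_zero)
  also have "\<dots> = \<kappa> powr (- \<rho>) * exp (- (\<rho> - \<bar>Re \<mu>\<bar>) * \<bar>v\<bar>)"
    by (simp add: algebra_simps flip: exp_add)
  finally show "norm (norm (exp (- \<mu> * of_real v)) * p v powr (- \<rho>)) \<le>
      \<kappa> powr (- \<rho>) * exp (- (\<rho> - \<bar>Re \<mu>\<bar>) * \<bar>v\<bar>)"
    by simp
qed

text \<open>
  The Beta integral in the variable \<open>ln (u / (1 - u))\<close>. Both sides times \<open>\<Gamma>(a + b)\<close> are values of
  the double integral of \<open>t\<^sup>(\<^sup>a\<^sup>+\<^sup>b\<^sup>-\<^sup>1\<^sup>) exp (- t (1 + exp v)) exp (a v)\<close>, taken in either order.
\<close>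

lemma Beta_integral_exp:
  fixes a b :: complex
  assumes a: "Re a > 0" and b: "Re b > 0"
  shows "(\<integral>v. exp (a * of_real v) * of_real (1 + exp v) powr (- (a + b)) \<partial>lborel) =
           Gamma a * Gamma b / Gamma (a + b)"
proof -
  have pos: "1 + exp v > 0" for v :: real
    by (simp add: add_pos_pos)
  have int: "integrable lborel (\<lambda>v. norm (exp (a * of_real v)) * (1 + exp v) powr (- Re (a + b)))"
  proof (rule integrable_of_exp_decay[where \<delta> = "min (Re a) (Re b)" and C = 1])
    show "min (Re a) (Re b) > 0"
      using a b by simp
    show "(\<lambda>v. norm (exp (a * of_real v)) * (1 + exp v) powr (- Re (a + b))) \<in> borel_measurable lborel"
      unfolding measurable_lborel2 using pos
      by (intro borel_measurable_continuous_onI continuous_intros) (auto simp: less_imp_neq[symmetric])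
    fix v :: real
    have "exp (Re a * v) * (1 + exp v) powr (- Re (a + b)) \<le> exp (- min (Re a) (Re b) * \<bar>v\<bar>)"
    proof (cases "v \<ge> 0")
      case True
      have "(1 + exp v) powr (- Re (a + b)) \<le> exp v powr (- Re (a + b))"
        using a b by (intro powr_mono2') auto
      then have "exp (Re a * v) * (1 + exp v) powr (- Re (a + b)) \<le> exp (Re a * v) * exp (- Re (a + b) * v)"
        by (intro mult_left_mono) (auto simp: powr_def)
      also have "\<dots> = exp (- Re b * v)"
        by (simp add: algebra_simps flip: exp_add)
      also have "\<dots> \<le> exp (- min (Re a) (Re b) * \<bar>v\<bar>)"
        using True by (simp add: mult_right_mono)
      finally show ?thesis .
    next
      case False
      have "(1 + exp v) powr (- Re (a + b)) \<le> 1 powr (- Re (a + b))"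
        using a b by (intro powr_mono2') auto
      then have "exp (Re a * v) * (1 + exp v) powr (- Re (a + b)) \<le> exp (Re a * v) * 1"
        by (intro mult_left_mono) auto
      also have "\<dots> \<le> exp (- min (Re a) (Re b) * \<bar>v\<bar>)"
        using False by (simp add: mult_right_mono_neg)
      finally show ?thesis .
    qed
    then show "norm (norm (exp (a * of_real v)) * (1 + exp v) powr (- Re (a + b))) \<le>
                 1 * exp (- min (Re a) (Re b) * \<bar>v\<bar>)"
      by simp
  qed
  have "Gamma (a + b) * (\<integral>v. exp (a * of_real v) * of_real (1 + exp v) powr (- (a + b)) \<partial>lborel) =
          (LBINT t:{0<..}. of_real t powr (a + b - 1) *
             (\<integral>v. of_real (exp (- t * (1 + exp v))) * exp (a * of_real v) \<partial>lborel))"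
    using a b pos int
    by (subst Laplace_powr_Fubini(2)) (auto intro!: continuous_intros)
  also have "\<dots> = (LBINT t:{0<..}. Gamma a * (of_real t powr (b - 1) * of_real (exp (- t * 1))))"
  proof (rule set_lebesgue_integral_cong)
    show "\<forall>t. t \<in> {0<..} \<longrightarrow> of_real t powr (a + b - 1) *
             (\<integral>v. of_real (exp (- t * (1 + exp v))) * exp (a * of_real v) \<partial>lborel) =
            Gamma a * (of_real t powr (b - 1) * of_real (exp (- t * 1)))"
    proof (intro allI impI)
      fix t :: real assume t: "t \<in> {0<..}"
      have "(\<integral>v. of_real (exp (- t * (1 + exp v))) * exp (a * of_real v) \<partial>lborel) =
              (\<integral>v. of_real (exp (- t)) * exp (a * of_real v - of_real (t * exp v)) \<partial>lborel)"
        by (intro Bochner_Integration.integral_cong refl)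
           (simp add: algebra_simps exp_add exp_diff exp_minus divide_inverse flip: exp_of_real)
      also have "\<dots> = of_real (exp (- t)) * (Gamma a * of_real t powr (- a))"
        using t a by (simp only: integral_mult_right_zero, subst integral_exp_linear_minus_exp) auto
      finally show "of_real t powr (a + b - 1) *
             (\<integral>v. of_real (exp (- t * (1 + exp v))) * exp (a * of_real v) \<partial>lborel) =
            Gamma a * (of_real t powr (b - 1) * of_real (exp (- t * 1)))"
        using t by (simp only:) (simp add: powr_add powr_diff powr_minus field_simps)
    qed
  qed simp
  also have "\<dots> = Gamma a * Gamma b"
    using Laplace_powr(2)[OF b, of 1] by (simp add: set_lebesgue_integral_def)
  finally show ?thesis
    using not_nonpos_Int_if_Re_pos[of "a + b"] a b by (simp add: Gamma_eq_zero_iff field_simps)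
qed

lemma one_plus_cosh_ge: "1 / 2 * exp \<bar>v\<bar> \<le> 1 + cosh (v::real)"
  using exp_abs_le_cosh[of v] by simp

lemma one_plus_cosh_pos: "0 < 1 + cosh (v::real)"
  using cosh_real_ge_1[of v] by linarith

lemma of_real_powr_eq_exp: "x > 0 \<Longrightarrow> of_real x powr a = exp (a * complex_of_real (ln x))"
  by (simp add: powr_def Ln_of_real)

text \<open>
  Since \<open>1 + cosh v = (1 + exp v)\<^sup>2 / (2 exp v)\<close>, this is a Beta integral.
\<close>

lemma integral_exp_one_plus_cosh_powr:
  fixes \<mu> a :: complex
  assumes a: "\<bar>Re \<mu>\<bar> < Re a"
  shows "(\<integral>v. exp (- \<mu> * of_real v) * of_real (1 + cosh v) powr (- a) \<partial>lborel) =
           2 powr a * (Gamma (a - \<mu>) * Gamma (a + \<mu>) / Gamma (2 * a))"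
proof -
  have "exp (- \<mu> * of_real v) * of_real (1 + cosh v) powr (- a) =
          2 powr a * (exp ((a - \<mu>) * of_real v) * of_real (1 + exp v) powr (- (a - \<mu> + (a + \<mu>))))" for v
  proof -
    have pos: "1 + exp v > 0"
      by (simp add: add_pos_pos)
    have "1 + cosh v = (1 + exp v)\<^sup>2 / (2 * exp v)"
      by (simp add: cosh_def exp_minus field_simps power2_eq_square)
    then have "ln (1 + cosh v) = ln ((1 + exp v)\<^sup>2 / (2 * exp v))"
      by (simp only:)
    also have "\<dots> = ln ((1 + exp v)\<^sup>2) - ln (2 * exp v)"
      using pos by (intro ln_divide_pos) auto
    also have "\<dots> = 2 * ln (1 + exp v) - (ln 2 + v)"
      using pos by (simp add: ln_mult_pos ln_realpow)
    finally have L: "ln (1 + cosh v) = 2 * ln (1 + exp v) - (ln 2 + v)" .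
    have two: "2 powr a = exp (a * complex_of_real (ln 2))"
      using of_real_powr_eq_exp[of 2 a] by simp
    show ?thesis
      unfolding of_real_powr_eq_exp[OF one_plus_cosh_pos] of_real_powr_eq_exp[OF pos] L two exp_add[symmetric]
      by (rule arg_cong[where f = exp]) (simp add: algebra_simps)
  qed
  then have "(\<integral>v. exp (- \<mu> * of_real v) * of_real (1 + cosh v) powr (- a) \<partial>lborel) =
      2 powr a * (\<integral>v. exp ((a - \<mu>) * of_real v) * of_real (1 + exp v) powr (- (a - \<mu> + (a + \<mu>))) \<partial>lborel)"
    by (simp only: integral_mult_right_zero)
  also have "(\<integral>v. exp ((a - \<mu>) * of_real v) * of_real (1 + exp v) powr (- (a - \<mu> + (a + \<mu>))) \<partial>lborel) =
      Gamma (a - \<mu>) * Gamma (a + \<mu>) / Gamma (a - \<mu> + (a + \<mu>))"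
    using a by (intro Beta_integral_exp) auto
  finally show ?thesis
    by simp
qed

text \<open>
  The weight and the ratio come from factoring \<open>w + cosh v = (1 + cosh v) * (1 - z * cosh_ratio v)\<close>
  with \<open>w = 1 - 2 * z\<close>. As the ratio stays in \<open>(0, 1]\<close>, the second factor avoids the negative real
  axis for \<open>z\<close> off the cut, and its powers have a binomial expansion for \<open>|z| < 1\<close>.
\<close>

definition cosh_weight :: "complex \<Rightarrow> complex \<Rightarrow> real \<Rightarrow> complex" where
  "cosh_weight a \<mu> v = exp (- \<mu> * of_real v) * of_real (1 + cosh v) powr (- a)"

definition cosh_ratio :: "real \<Rightarrow> real" where
  "cosh_ratio v = 2 / (1 + cosh v)"

definition hyp_integral :: "complex \<Rightarrow> complex \<Rightarrow> complex \<Rightarrow> complex" where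
  "hyp_integral a \<mu> z = (\<integral>v. cosh_weight a \<mu> v * (1 - z * of_real (cosh_ratio v)) powr (- a) \<partial>lborel)"

lemma cosh_ratio_bounds: "0 < cosh_ratio v" "cosh_ratio v \<le> 1"
  using one_plus_cosh_pos[of v] cosh_real_ge_1[of v] by (simp_all add: cosh_ratio_def)

lemma continuous_on_cosh_weight: "continuous_on UNIV (cosh_weight a \<mu>)"
proof -
  have "complex_of_real (1 + cosh v) \<notin> \<real>\<^sub>\<le>\<^sub>0" for v
    using one_plus_cosh_pos[of v] by (auto simp: complex_nonpos_Reals_iff)
  then show ?thesis
    unfolding cosh_weight_def by (intro continuous_intros continuous_on_powr_slit)
qed

lemma continuous_on_cosh_ratio: "continuous_on UNIV cosh_ratio"
  unfolding cosh_ratio_def by (intro continuous_intros) (metis one_plus_cosh_pos less_irrefl)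

lemma integrable_cosh_weight:
  assumes "\<bar>Re \<mu>\<bar> < Re a"
  shows "integrable lborel (\<lambda>v. norm (cosh_weight a \<mu> v))"
proof -
  have "norm (cosh_weight a \<mu> v) = norm (exp (- \<mu> * of_real v)) * (1 + cosh v) powr (- Re a)" for v
    using norm_powr_of_real[OF one_plus_cosh_pos[of v], of "- a"] by (simp add: cosh_weight_def norm_mult)
  moreover have "integrable lborel (\<lambda>v. norm (exp (- \<mu> * of_real v)) * (1 + cosh v) powr (- Re a))"
    by (rule integrable_exp_powr[of "1/2", OF _ one_plus_cosh_ge _ assms]) (auto intro!: continuous_intros)
  ultimately show ?thesis
    by (simp only:)
qed

lemma one_minus_mult_notin_nonpos_Reals:
  assumes z: "z \<in> slit_plane" and x: "0 \<le> x" "x \<le> 1"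
  shows "1 - z * of_real x \<notin> \<real>\<^sub>\<le>\<^sub>0"
proof
  assume "1 - z * of_real x \<in> \<real>\<^sub>\<le>\<^sub>0"
  then have *: "1 \<le> Re z * x" "Im z * x = 0"
    by (auto simp: complex_nonpos_Reals_iff)
  then have "x > 0"
    using x by (cases "x = 0") auto
  then have "Im z = 0"
    using * by simp
  have "1 \<le> Re z"
  proof (rule ccontr)
    assume "\<not> 1 \<le> Re z"
    then have "Re z * x < 1 * x"
      using \<open>x > 0\<close> by (intro mult_strict_right_mono) auto
    then show False
      using * x by simp
  qed
  have "z = of_real (Re z)"
    using \<open>Im z = 0\<close> by (simp add: complex_eq_iff)
  then show False
    using z \<open>1 \<le> Re z\<close> unfolding slit_plane_def by (metis ComplI Compl_iff atLeast_iff imageI)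
qed

text \<open>
  Continuity on the compact set \<open>K \<times> [0, 1]\<close>; this yields majorants locally uniform in \<open>z\<close>.
\<close>

lemma one_minus_mult_powr_bounded:
  assumes K: "compact K" "K \<subseteq> slit_plane"
  obtains B where "B \<ge> 0" "\<And>z x. z \<in> K \<Longrightarrow> 0 \<le> x \<Longrightarrow> x \<le> 1 \<Longrightarrow> norm ((1 - z * of_real x) powr a) \<le> B"
proof -
  have "continuous_on (K \<times> {0..1}) (\<lambda>y. (1 - fst y * of_real (snd y)) powr a)"
  proof (rule continuous_on_powr_slit)
    show "1 - fst y * of_real (snd y) \<notin> \<real>\<^sub>\<le>\<^sub>0" if "y \<in> K \<times> {0..1}" for y
      using that K(2) by (intro one_minus_mult_notin_nonpos_Reals) auto
  qed (intro continuous_intros)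
  then have "bounded ((\<lambda>y. (1 - fst y * of_real (snd y)) powr a) ` (K \<times> {0..1}))"
    by (intro compact_imp_bounded compact_continuous_image compact_Times K(1)) auto
  then obtain B where "B > 0" "\<forall>y\<in>K \<times> {0..1}. norm ((1 - fst y * of_real (snd y)) powr a) \<le> B"
    unfolding bounded_pos by auto
  then show ?thesis
    by (intro that[of B]) auto
qed

lemma continuous_on_hyp_integrand:
  assumes "z \<in> slit_plane"
  shows "continuous_on UNIV (\<lambda>v. cosh_weight a \<mu> v * (1 - z * of_real (cosh_ratio v)) powr b)"
proof -
  have "1 - z * of_real (cosh_ratio v) \<notin> \<real>\<^sub>\<le>\<^sub>0" for v
    using cosh_ratio_bounds[of v] by (intro one_minus_mult_notin_nonpos_Reals[OF assms]) auto
  then show ?thesis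
    by (intro continuous_on_mult continuous_on_diff continuous_on_of_real continuous_on_const
          continuous_on_powr_slit continuous_on_cosh_weight continuous_on_cosh_ratio)
qed

lemma integrable_hyp_integrand:
  assumes a: "\<bar>Re \<mu>\<bar> < Re a" and z: "z \<in> slit_plane"
  shows "integrable lborel (\<lambda>v. cosh_weight a \<mu> v * (1 - z * of_real (cosh_ratio v)) powr b)"
proof -
  have "compact {z}" "{z} \<subseteq> slit_plane"
    using z by auto
  then obtain B where B: "B \<ge> 0" "\<And>x. 0 \<le> x \<Longrightarrow> x \<le> 1 \<Longrightarrow> norm ((1 - z * of_real x) powr b) \<le> B"
    using one_minus_mult_powr_bounded[of "{z}" b] by (metis singletonI)
  show ?thesis
  proof (rule Bochner_Integration.integrable_bound)
    show "integrable lborel (\<lambda>v. norm (cosh_weight a \<mu> v) * B)"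
      by (intro integrable_mult_left integrable_cosh_weight a)
    show "(\<lambda>v. cosh_weight a \<mu> v * (1 - z * of_real (cosh_ratio v)) powr b) \<in> borel_measurable lborel"
      unfolding measurable_lborel2
      by (intro borel_measurable_continuous_onI continuous_on_hyp_integrand z)
    show "AE v in lborel. norm (cosh_weight a \<mu> v * (1 - z * of_real (cosh_ratio v)) powr b) \<le>
            norm (norm (cosh_weight a \<mu> v) * B)"
    proof (rule AE_I2)
      fix v :: real
      have "norm ((1 - z * of_real (cosh_ratio v)) powr b) \<le> B"
        using cosh_ratio_bounds[of v] by (intro B(2)) auto
      then have "norm (cosh_weight a \<mu> v) * norm ((1 - z * of_real (cosh_ratio v)) powr b) \<le>
          norm (cosh_weight a \<mu> v) * B"
        by (rule mult_left_mono) simp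
      then show "norm (cosh_weight a \<mu> v * (1 - z * of_real (cosh_ratio v)) powr b) \<le>
            norm (norm (cosh_weight a \<mu> v) * B)"
        using B(1) by (simp add: norm_mult)
    qed
  qed
qed

lemma holomorphic_hyp_integral:
  assumes a: "\<bar>Re \<mu>\<bar> < Re a"
  shows "hyp_integral a \<mu> holomorphic_on slit_plane"
  unfolding holomorphic_on_open[OF open_slit_plane]
proof
  fix z0 assume z0: "z0 \<in> slit_plane"
  obtain e where e: "e > 0" "cball z0 e \<subseteq> slit_plane"
    using open_slit_plane z0 unfolding open_contains_cball by blast
  obtain B where B: "B \<ge> 0"
    "\<And>z x. z \<in> cball z0 e \<Longrightarrow> 0 \<le> x \<Longrightarrow> x \<le> 1 \<Longrightarrow> norm ((1 - z * of_real x) powr (- a - 1)) \<le> B"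
    using one_minus_mult_powr_bounded[OF compact_cball e(2)] by blast
  define f' where "f' z v = a * of_real (cosh_ratio v) *
      (cosh_weight a \<mu> v * (1 - z * of_real (cosh_ratio v)) powr (- a - 1))" for z v
  have "((\<lambda>z. \<integral>v. cosh_weight a \<mu> v * (1 - z * of_real (cosh_ratio v)) powr (- a) \<partial>lborel)
          has_field_derivative (\<integral>v. f' z0 v \<partial>lborel)) (at z0)"
  proof (rule has_field_derivative_integral_dominated[where S = "ball z0 e"
            and g = "\<lambda>v. norm a * B * norm (cosh_weight a \<mu> v)"])
    show "integrable lborel (\<lambda>v. cosh_weight a \<mu> v * (1 - z * of_real (cosh_ratio v)) powr (- a))"
      if "z \<in> ball z0 e" for z
      using that e(2) by (intro integrable_hyp_integrand a) auto
    show "integrable lborel (\<lambda>v. norm a * B * norm (cosh_weight a \<mu> v))"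
      by (intro integrable_mult_right integrable_cosh_weight a)
    show "f' z0 \<in> borel_measurable lborel"
      unfolding measurable_lborel2 f'_def
      by (intro borel_measurable_continuous_onI continuous_on_mult continuous_on_hyp_integrand z0
            continuous_on_const continuous_on_of_real continuous_on_cosh_ratio)
    fix z v assume "z \<in> ball z0 e"
    then have z: "z \<in> slit_plane" "z \<in> cball z0 e"
      using e(2) by auto
    have "1 - z * of_real (cosh_ratio v) \<notin> \<real>\<^sub>\<le>\<^sub>0"
      using cosh_ratio_bounds[of v] by (intro one_minus_mult_notin_nonpos_Reals[OF z(1)]) auto
    then show "((\<lambda>z. cosh_weight a \<mu> v * (1 - z * of_real (cosh_ratio v)) powr (- a)) has_field_derivative f' z v) (at z)"
      unfolding f'_def by (auto intro!: derivative_eq_intros)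
    have "norm (f' z v) = norm a * norm (cosh_ratio v) * (norm (cosh_weight a \<mu> v) *
            norm ((1 - z * of_real (cosh_ratio v)) powr (- a - 1)))"
      by (simp add: f'_def norm_mult)
    also have "\<dots> \<le> norm a * 1 * (norm (cosh_weight a \<mu> v) * B)"
      using cosh_ratio_bounds[of v] by (intro mult_mono mult_nonneg_nonneg B(2)[OF z(2)]) auto
    finally show "norm (f' z v) \<le> norm a * B * norm (cosh_weight a \<mu> v)"
      by (simp add: mult_ac)
  qed (use e in auto)
  then show "\<exists>f'. (hyp_integral a \<mu> has_field_derivative f') (at z0)"
    unfolding hyp_integral_def[abs_def] by blast
qed

text \<open>
  Expand \<open>(1 - z * cosh_ratio v) powr (- a)\<close> by the binomial series. Integrating the \<open>n\<close>-th term
  merely replaces \<open>a\<close> by \<open>b = a + n\<close> in the Beta integral, and Legendre's duplication formula splits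
  \<open>\<Gamma>(2 b)\<close> into \<open>\<Gamma>(b)\<close>, which cancels the Pochhammer symbol of the binomial coefficient, and
  \<open>\<Gamma>(b + 1/2)\<close>, the denominator of the hypergeometric coefficient.
\<close>

lemma hyp_integral_eq_series:
  assumes a: "\<bar>Re \<mu>\<bar> < Re a" and z: "norm z < 1"
  shows "hyp_integral a \<mu> z = 2 powr (1 - a) * of_real (sqrt pi) * Gamma (a - \<mu>) * Gamma (a + \<mu>) * rGamma a *
           hypergeom_reg_series (a - \<mu>) (a + \<mu>) (a + 1 / 2) z"
proof -
  define C where "C = 2 powr (1 - a) * of_real (sqrt pi) * Gamma (a - \<mu>) * Gamma (a + \<mu>) * rGamma a"
  define w where "w n = pochhammer a n / fact n * z ^ n" for n
  define F where "F n v = w n * (cosh_weight a \<mu> v * of_real (cosh_ratio v ^ n))" for n v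
  have sumw: "summable (\<lambda>n. norm (w n))"
  proof -
    have "norm z < norm (of_real ((1 + norm z) / 2) :: complex)" "norm (of_real ((1 + norm z) / 2) :: complex) < 1"
      using z by (simp_all add: norm_divide abs_of_nonneg del: of_real_add)
    then show ?thesis
      unfolding w_def using powser_insidea[OF sums_summable[OF one_minus_powr_sums]] by blast
  qed
  have "norm (cosh_ratio v ^ n) \<le> 1" for v n
    using cosh_ratio_bounds[of v] by (simp add: power_le_one)
  then have normF: "norm (F n v) \<le> norm (w n) * norm (cosh_weight a \<mu> v)" for n v
    unfolding F_def norm_mult norm_of_real by (intro mult_left_mono mult_left_le) auto
  have intF: "integrable lborel (F n)" for n
  proof (rule Bochner_Integration.integrable_bound)
    show "integrable lborel (\<lambda>v. norm (w n) * norm (cosh_weight a \<mu> v))"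
      by (intro integrable_mult_right integrable_cosh_weight a)
    show "F n \<in> borel_measurable lborel"
      unfolding F_def measurable_lborel2
      by (intro borel_measurable_continuous_onI continuous_intros continuous_on_cosh_weight continuous_on_cosh_ratio)
  qed (use normF in auto)
  have "(\<lambda>n. \<integral>v. F n v \<partial>lborel) sums (\<integral>v. (\<Sum>n. F n v) \<partial>lborel)"
  proof (rule sums_integral)
    show "AE v in lborel. summable (\<lambda>n. norm (F n v))"
      using normF by (intro AE_I2 summable_comparison_test'[OF summable_mult2[OF sumw]]) auto
    have "(\<integral>v. norm (F n v) \<partial>lborel) \<le> norm (w n) * (\<integral>v. norm (cosh_weight a \<mu> v) \<partial>lborel)" for n
      unfolding integral_mult_right_zero[symmetric]
      using normF intF by (intro integral_mono integrable_mult_right integrable_cosh_weight a integrable_norm)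
    then show "summable (\<lambda>n. \<integral>v. norm (F n v) \<partial>lborel)"
      by (intro summable_comparison_test'[OF summable_mult2[OF sumw]]) auto
  qed (rule intF)
  moreover have "(\<Sum>n. F n v) = cosh_weight a \<mu> v * (1 - z * of_real (cosh_ratio v)) powr (- a)" for v
  proof -
    have "norm (z * of_real (cosh_ratio v)) \<le> norm z * 1"
      unfolding norm_mult using cosh_ratio_bounds[of v] by (intro mult_left_mono) auto
    then have "norm (z * of_real (cosh_ratio v)) < 1"
      using z by simp
    from sums_mult[OF one_minus_powr_sums[OF this, of a], of "cosh_weight a \<mu> v"] show ?thesis
      unfolding F_def w_def by (simp add: sums_iff power_mult_distrib mult_ac)
  qed
  moreover have "(\<integral>v. F n v \<partial>lborel) = C * (hyp_coeff (a - \<mu>) (a + \<mu>) (a + 1 / 2) n * z ^ n)" for n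
  proof -
    define b where "b = a + of_nat n"
    have Reb: "\<bar>Re \<mu>\<bar> < Re b" "Re b > 0"
      using a by (auto simp: b_def)
    have "cosh_weight a \<mu> v * of_real (cosh_ratio v ^ n) =
            2 ^ n * (exp (- \<mu> * of_real v) * of_real (1 + cosh v) powr (- b))" for v
    proof -
      have "complex_of_real (1 + cosh v) powr (- b) = of_real (1 + cosh v) powr (- a) / of_real (1 + cosh v) ^ n"
        using one_plus_cosh_pos[of v] unfolding b_def
        by (simp add: powr_diff powr_nat' del: of_real_add)
      then show ?thesis
        by (simp add: cosh_weight_def cosh_ratio_def power_divide)
    qed
    then have "(\<integral>v. F n v \<partial>lborel) = w n * (2 ^ n * (2 powr b * (Gamma (b - \<mu>) * Gamma (b + \<mu>) / Gamma (2 * b))))"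
      unfolding F_def integral_mult_right_zero
      by (simp only: integral_mult_right_zero integral_exp_one_plus_cosh_powr[OF Reb(1)])
    also have "\<dots> = 2 ^ n * 2 powr b * (pochhammer a n * rGamma (2 * b)) * Gamma (b - \<mu>) * Gamma (b + \<mu>) * z ^ n / fact n"
      by (simp add: w_def Gamma_def divide_inverse mult_ac)
    also have "pochhammer a n * rGamma (2 * b) =
        exp ((1 - 2 * b) * of_real (ln 2)) * of_real (sqrt pi) * rGamma (b + 1 / 2) * rGamma a"
    proof -
      have "b \<notin> \<int>\<^sub>\<le>\<^sub>0" "b + 1 / 2 \<notin> \<int>\<^sub>\<le>\<^sub>0" "2 * b \<notin> \<int>\<^sub>\<le>\<^sub>0" "a \<notin> \<int>\<^sub>\<le>\<^sub>0"
        using Reb a by (intro not_nonpos_Int_if_Re_pos; simp)+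
      then show ?thesis
        using Gamma_legendre_duplication[of b]
        by (simp add: pochhammer_Gamma Gamma_eq_zero_iff rGamma_inverse_Gamma field_simps flip: b_def)
    qed
    also have "Gamma (b - \<mu>) = pochhammer (a - \<mu>) n * Gamma (a - \<mu>)"
      using a not_nonpos_Int_if_Re_pos[of "a - \<mu>"]
      by (simp add: pochhammer_Gamma b_def Gamma_eq_zero_iff algebra_simps)
    also have "Gamma (b + \<mu>) = pochhammer (a + \<mu>) n * Gamma (a + \<mu>)"
      using a not_nonpos_Int_if_Re_pos[of "a + \<mu>"]
      by (simp add: pochhammer_Gamma b_def Gamma_eq_zero_iff algebra_simps)
    finally have "(\<integral>v. F n v \<partial>lborel) =
        (2 ^ n * (2 powr b * exp ((1 - 2 * b) * of_real (ln 2)))) * of_real (sqrt pi) * Gamma (a - \<mu>) * Gamma (a + \<mu>) *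
        rGamma a * (pochhammer (a - \<mu>) n * pochhammer (a + \<mu>) n * rGamma (b + 1 / 2) / fact n * z ^ n)"
      by (simp only: mult_ac times_divide_eq_left times_divide_eq_right)
    moreover have "2 ^ n * (2 powr b * exp ((1 - 2 * b) * of_real (ln 2))) = 2 powr (1 - a)"
    proof -
      have two: "2 powr x = exp (x * complex_of_real (ln 2))" for x
        using of_real_powr_eq_exp[of 2 x] by simp
      have "(2::complex) ^ n = exp (of_nat n * of_real (ln 2))"
        using two[of "of_nat n"] by simp
      then show ?thesis
        unfolding two b_def by (simp only:) (simp add: algebra_simps flip: exp_add)
    qed
    moreover have "a + 1 / 2 + of_nat n = b + 1 / 2"
      by (simp add: b_def)
    ultimately show ?thesis
      unfolding C_def hyp_coeff_def by (simp only:)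
  qed
  ultimately have "(\<lambda>n. C * (hyp_coeff (a - \<mu>) (a + \<mu>) (a + 1 / 2) n * z ^ n)) sums hyp_integral a \<mu> z"
    unfolding hyp_integral_def by simp
  moreover have "(\<lambda>n. C * (hyp_coeff (a - \<mu>) (a + \<mu>) (a + 1 / 2) n * z ^ n)) sums
                    (C * hypergeom_reg_series (a - \<mu>) (a + \<mu>) (a + 1 / 2) z)"
    unfolding hypergeom_reg_series_eq
    by (intro sums_mult summable_sums summable_norm_cancel[OF summable_norm_hyp_coeff] z)
  ultimately show ?thesis
    unfolding C_def by (rule sums_unique2)
qed

text \<open>
  The right-hand side is holomorphic off the cut, and on the unit disc it is the required series by
  Euler's transformation. Hence it is the continuation, up to a nonzero constant.
\<close>

lemma hypergeom_reg_eq_integral: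
  assumes a: "\<bar>Re \<mu>\<bar> < Re a" and z: "z \<in> slit_plane"
  shows "2 powr (1 - a) * of_real (sqrt pi) * Gamma (a - \<mu>) * Gamma (a + \<mu>) * rGamma a *
           hypergeom_reg (1 / 2 + \<mu>) (1 / 2 - \<mu>) (a + 1 / 2) z =
         (1 - z) powr (a - 1 / 2) * hyp_integral a \<mu> z"
proof -
  define C where "C = 2 powr (1 - a) * of_real (sqrt pi) * Gamma (a - \<mu>) * Gamma (a + \<mu>) * rGamma a"
  have C: "C \<noteq> 0"
    using a not_nonpos_Int_if_Re_pos[of "a - \<mu>"] not_nonpos_Int_if_Re_pos[of "a + \<mu>"] not_nonpos_Int_if_Re_pos[of a]
    by (simp add: C_def Gamma_eq_zero_iff rGamma_eq_zero_iff)
  have "is_hypergeom_reg_continuation (1 / 2 + \<mu>) (1 / 2 - \<mu>) (a + 1 / 2)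
          (\<lambda>z. (1 - z) powr (a - 1 / 2) * hyp_integral a \<mu> z / C)"
    unfolding is_hypergeom_reg_continuation_def
  proof (intro conjI ballI)
    have "1 - u \<notin> \<real>\<^sub>\<le>\<^sub>0" if "u \<in> slit_plane" for u
      using one_minus_mult_notin_nonpos_Reals[OF that, of 1] by simp
    then show "(\<lambda>z. (1 - z) powr (a - 1 / 2) * hyp_integral a \<mu> z / C) holomorphic_on slit_plane"
      using C by (intro holomorphic_intros holomorphic_hyp_integral a) auto
    fix u :: complex assume "u \<in> ball 0 1"
    then have u: "norm u < 1"
      by simp
    have "a + 1 / 2 + of_nat n \<noteq> 0" for n
      using a by (auto simp: complex_eq_iff)
    from Euler_transformation[OF this u, of "a - \<mu>" "a + \<mu>"]
    have "hypergeom_reg_series (1 / 2 + \<mu>) (1 / 2 - \<mu>) (a + 1 / 2) u =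
            (1 - u) powr (a - 1 / 2) * hypergeom_reg_series (a - \<mu>) (a + \<mu>) (a + 1 / 2) u"
      by (simp add: algebra_simps)
    then show "(1 - u) powr (a - 1 / 2) * hyp_integral a \<mu> u / C =
            hypergeom_reg_series (1 / 2 + \<mu>) (1 / 2 - \<mu>) (a + 1 / 2) u"
      unfolding hyp_integral_eq_series[OF a u] C_def[symmetric] using C by simp
  qed
  from hypergeom_reg_eqI[OF this z] show ?thesis
    unfolding C_def[symmetric] using C by simp
qed

section \<open>Laplace transforms of Bessel functions\<close>

lemma Gamma_add_double:
  assumes "Re a > 0"
  shows "Gamma (a + 2 * of_nat k) = Gamma a * (4 ^ k * pochhammer (a / 2) k * pochhammer ((a + 1) / 2) k)"
proof -
  have "Gamma (a + of_nat (2 * k)) = pochhammer a (2 * k) * Gamma a"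
    using assms not_nonpos_Int_if_Re_pos[OF assms] by (simp add: pochhammer_Gamma Gamma_eq_zero_iff)
  also have "pochhammer a (2 * k) = 4 ^ k * pochhammer (a / 2) k * pochhammer ((a + 1) / 2) k"
    using pochhammer_double[of "a / 2" k] by (simp add: add_divide_distrib power_mult)
  finally show ?thesis
    by (simp add: mult_ac)
qed

text \<open>
  The factor \<open>4 ^ k\<close> from \<open>Gamma_add_double\<close> cancels the powers of \<open>2\<close> in the Bessel series. The parameter \<open>a\<close> is independent of \<open>\<mu>\<close>, because the
  identity is also used for the real part of \<open>\<nu> + \<mu> + 1\<close> when norms are estimated.
\<close>

lemma Laplace_bessel_I_term:
  assumes a: "Re a > 0" and s: "s > 0" and c: "c > (0::real)"
  shows "(of_real (s / 2) powr (\<mu> + 2 * of_nat k) * bessel_coeff \<mu> k) *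
           (Gamma (a + 2 * of_nat k) * of_real c powr (- (a + 2 * of_nat k))) =
         of_real (s / 2) powr \<mu> * Gamma a * of_real c powr (- a) *
           (hyp_coeff (a / 2) ((a + 1) / 2) (\<mu> + 1) k * of_real ((s / c)\<^sup>2) ^ k)"
proof -
  have pow: "of_real x powr (2 * of_nat k) = complex_of_real x ^ (2 * k)" if "x > 0" for x :: real
    using that powr_nat'[of "complex_of_real x" "2 * k"] by simp
  have 1: "of_real (s / 2) powr (\<mu> + 2 * of_nat k) = complex_of_real (s / 2) powr \<mu> * of_real (s / 2) ^ (2 * k)"
    using pow[of "s / 2"] s by (simp add: powr_add del: of_real_divide)
  have 2: "of_real c powr (- (a + 2 * of_nat k)) = complex_of_real c powr (- a) / of_real c ^ (2 * k)"
    using pow[of c] c by (simp add: powr_diff powr_minus powr_add field_simps)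
  have 3: "bessel_coeff \<mu> k = rGamma (\<mu> + 1 + of_nat k) / fact k"
    by (simp add: bessel_coeff_def add_ac)
  have 4: "complex_of_real (s / 2) ^ (2 * k) * 4 ^ k / of_real c ^ (2 * k) = of_real ((s / c)\<^sup>2) ^ k"
  proof -
    have "(4::complex) ^ k = 2 ^ (2 * k)"
      by (simp add: power_mult)
    then show ?thesis
      by (simp add: power_divide flip: power_mult)
  qed
  have "(of_real (s / 2) powr (\<mu> + 2 * of_nat k) * bessel_coeff \<mu> k) *
           (Gamma (a + 2 * of_nat k) * of_real c powr (- (a + 2 * of_nat k))) =
        of_real (s / 2) powr \<mu> * Gamma a * of_real c powr (- a) *
          (pochhammer (a / 2) k * pochhammer ((a + 1) / 2) k * rGamma (\<mu> + 1 + of_nat k) / fact k *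
            (of_real (s / 2) ^ (2 * k) * 4 ^ k / of_real c ^ (2 * k)))"
    unfolding 1 2 3 Gamma_add_double[OF a] by (simp only: divide_inverse mult_ac)
  then show ?thesis
    unfolding 4 hyp_coeff_def .
qed

text \<open>
  Term by term integration. The integrals of the norms of the terms are, up to a constant factor, the
  norms of the terms of a hypergeometric series at \<open>(s / c)\<^sup>2 < 1\<close>.
\<close>

lemma Laplace_bessel_I:
  fixes \<nu> \<mu> :: complex and s c :: real
  assumes s: "0 < s" "s < c" and re: "Re (\<nu> + \<mu>) > -1"
  defines "f \<equiv> \<lambda>t. of_real (exp (- t * c)) * of_real t powr \<nu> * bessel_I \<mu> (of_real (t * s))"
  shows "set_integrable lborel {0<..} f"
    and "(LBINT t:{0<..}. f t) = of_real (s / 2) powr \<mu> * Gamma (\<nu> + \<mu> + 1) * of_real c powr (- (\<nu> + \<mu> + 1)) *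
           hypergeom_reg_series ((\<nu> + \<mu> + 1) / 2) ((\<nu> + \<mu> + 1 + 1) / 2) (\<mu> + 1) (of_real ((s / c)\<^sup>2))"
proof -
  define a where "a = \<nu> + \<mu> + 1"
  have a: "Re a > 0" "Re (a + 2 * of_nat k) > 0" for k
    using re by (simp_all add: a_def add_pos_nonneg)
  have c: "c > 0"
    using s by simp
  define \<kappa> where "\<kappa> k = of_real (s / 2) powr (\<mu> + 2 * of_nat k) * bessel_coeff \<mu> k" for k
  define L where "L k t = indicator {0<..} t *\<^sub>R
      (of_real t powr (a + 2 * of_nat k - 1) * complex_of_real (exp (- t * c)))" for k :: nat and t :: real
  define C where "C b = of_real (s / 2) powr \<mu> * Gamma b * of_real c powr (- b)" for b
  define h where "h b k = hyp_coeff (b / 2) ((b + 1) / 2) (\<mu> + 1) k * of_real ((s / c)\<^sup>2) ^ k" for b k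
  have "(s / c)\<^sup>2 < 1\<^sup>2"
    using s by (intro power_strict_mono) auto
  then have sumh: "summable (\<lambda>k. norm (h b k))" for b
    unfolding h_def by (intro summable_norm_hyp_coeff) (simp add: norm_power norm_divide power_divide)
  have intL: "integrable lborel (L k)" for k
    using Laplace_powr(1)[OF a(2) c] unfolding L_def set_integrable_def .
  have laplace: "(\<integral>t. \<kappa> k * L k t \<partial>lborel) = C a * h a k" for k
  proof -
    have "(\<integral>t. L k t \<partial>lborel) = Gamma (a + 2 * of_nat k) * of_real c powr (- (a + 2 * of_nat k))"
      using Laplace_powr(2)[OF a(2) c, of k] unfolding L_def set_lebesgue_integral_def .
    then show ?thesis
      unfolding integral_mult_right_zero \<kappa>_def C_def h_def
      by (simp only: Laplace_bessel_I_term[OF a(1) s(1) c])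
  qed
  have laplace_norm: "(\<integral>t. norm (\<kappa> k * L k t) \<partial>lborel) = norm (C (of_real (Re a))) * norm (h (of_real (Re a)) k)" for k
  proof -
    have pos: "Re a + 2 * real k > 0"
      using a(2)[of k] by simp
    have "(\<integral>t. norm (\<kappa> k * L k t) \<partial>lborel) = norm (\<kappa> k) * (Gamma (Re a + 2 * real k) * c powr (- (Re a + 2 * real k)))"
      using Laplace_powr_norm[OF a(2) c, of k] unfolding L_def norm_mult integral_mult_right_zero by simp
    also have "Gamma (Re a + 2 * real k) * c powr (- (Re a + 2 * real k)) =
        norm (Gamma (of_real (Re a) + 2 * of_nat k) * complex_of_real c powr (- (of_real (Re a) + 2 * of_nat k)))"
    proof -
      have "Gamma (of_real (Re a) + 2 * of_nat k) = complex_of_real (Gamma (Re a + 2 * real k))"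
        by (simp flip: Gamma_complex_of_real)
      then show ?thesis
        using norm_powr_of_real[OF c, of "- (of_real (Re a) + 2 * of_nat k)"] Gamma_real_pos[OF pos]
        by (simp add: norm_mult)
    qed
    also have "norm (\<kappa> k) * \<dots> = norm (C (of_real (Re a)) * h (of_real (Re a)) k)"
      unfolding norm_mult[symmetric] \<kappa>_def C_def h_def
      using a(1) by (subst Laplace_bessel_I_term[OF _ s(1) c]) auto
    finally show ?thesis
      by (simp add: norm_mult)
  qed
  have series: "(\<lambda>k. \<kappa> k * L k t) = (\<lambda>k. indicator {0<..} t *\<^sub>R (of_real (exp (- t * c)) * of_real t powr \<nu> *
      (of_real (t * s / 2) powr \<mu> * (bessel_coeff \<mu> k * ((of_real (t * s / 2))\<^sup>2) ^ k))))" for t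
  proof (cases "t > 0")
    case True
    have "of_real (s / 2) powr (\<mu> + 2 * of_nat k) * complex_of_real t powr (a + 2 * of_nat k - 1) =
            of_real t powr \<nu> * (of_real (t * s / 2) powr \<mu> * (((of_real (t * s / 2))\<^sup>2) ^ k))" for k
    proof -
      have "of_real (s / 2) powr (\<mu> + 2 * of_nat k) * complex_of_real t powr (a + 2 * of_nat k - 1) =
              of_real t powr \<nu> * (of_real (s / 2) powr (\<mu> + 2 * of_nat k) * of_real t powr (\<mu> + 2 * of_nat k))"
        using True by (simp add: a_def powr_add)
      also have "of_real (s / 2) powr (\<mu> + 2 * of_nat k) * of_real t powr (\<mu> + 2 * of_nat k) =
                   complex_of_real (t * s / 2) powr (\<mu> + 2 * of_nat k)"
        using True s powr_times_real[of "of_real (s / 2)" "of_real t"] by (simp add: mult_ac)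
      also have "\<dots> = complex_of_real (t * s / 2) powr \<mu> * ((of_real (t * s / 2))\<^sup>2) ^ k"
        using True s powr_nat'[of "complex_of_real (t * s / 2)" "2 * k"]
        by (simp add: powr_add power_mult del: of_real_divide of_real_mult)
      finally show ?thesis .
    qed
    then show ?thesis
      using True by (simp add: \<kappa>_def L_def fun_eq_iff)
  qed (simp add: L_def)
  have sumb: "summable (\<lambda>k. norm (bessel_coeff \<mu> k * w ^ k))" for w
    by (rule powser_insidea[OF summable_bessel_coeff[of \<mu> "of_real (norm w + 1)"]])
       (simp del: of_real_add)
  have ae: "AE t in lborel. summable (\<lambda>k. norm (\<kappa> k * L k t))"
  proof (rule AE_I2)
    fix t :: real
    have "norm (\<kappa> k * L k t) = norm (indicator {0<..} t *\<^sub>R (of_real (exp (- t * c)) * of_real t powr \<nu> *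
      of_real (t * s / 2) powr \<mu>)) * norm (bessel_coeff \<mu> k * ((of_real (t * s / 2))\<^sup>2) ^ k)" for k
      unfolding fun_cong[OF series] norm_scaleR norm_mult by (simp only: mult_ac)
    then show "summable (\<lambda>k. norm (\<kappa> k * L k t))"
      by (simp only: summable_mult[OF sumb])
  qed
  have suml: "summable (\<lambda>k. \<integral>t. norm (\<kappa> k * L k t) \<partial>lborel)"
    unfolding laplace_norm by (intro summable_mult sumh)
  have total: "(\<Sum>k. \<kappa> k * L k t) = indicator {0<..} t *\<^sub>R f t" for t
  proof (cases "t > 0")
    case True
    have "(\<lambda>k. \<kappa> k * L k t) = (\<lambda>k. of_real (exp (- t * c)) * of_real t powr \<nu> * of_real (t * s / 2) powr \<mu> *
            (bessel_coeff \<mu> k * ((of_real (t * s / 2))\<^sup>2) ^ k))"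
      unfolding series using True by (simp add: mult.assoc)
    then have "(\<Sum>k. \<kappa> k * L k t) = of_real (exp (- t * c)) * of_real t powr \<nu> * of_real (t * s / 2) powr \<mu> *
            bessel_entire \<mu> ((of_real (t * s / 2))\<^sup>2)"
      unfolding bessel_entire_def by (simp only: suminf_mult[OF summable_bessel_coeff])
    also have "\<dots> = f t"
      using True s bessel_I_eq[of "of_real (t * s)" \<mu>] by (simp add: f_def)
    finally show ?thesis
      using True by simp
  qed (simp add: L_def)
  show "set_integrable lborel {0<..} f"
    using integrable_suminf[OF integrable_mult_right[OF intL] ae suml] unfolding total set_integrable_def .
  have "(\<lambda>k. C a * h a k) sums (LBINT t:{0<..}. f t)"
    using sums_integral[OF integrable_mult_right[OF intL] ae suml]
    unfolding total set_lebesgue_integral_def laplace .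
  moreover have "(\<lambda>k. C a * h a k) sums (C a * (\<Sum>k. h a k))"
    by (intro sums_mult summable_sums summable_norm_cancel[OF sumh])
  ultimately have "(LBINT t:{0<..}. f t) = C a * (\<Sum>k. h a k)"
    by (rule sums_unique2)
  then show "(LBINT t:{0<..}. f t) = of_real (s / 2) powr \<mu> * Gamma (\<nu> + \<mu> + 1) * of_real c powr (- (\<nu> + \<mu> + 1)) *
           hypergeom_reg_series ((\<nu> + \<mu> + 1) / 2) ((\<nu> + \<mu> + 1 + 1) / 2) (\<mu> + 1) (of_real ((s / c)\<^sup>2))"
    unfolding C_def h_def a_def hypergeom_reg_series_eq .
qed

text \<open>
  After inserting the integral for \<open>K\<close>, the exponent \<open>- t c - t s cosh v\<close> is linear in \<open>t\<close>, so
  \<open>Laplace_powr_Fubini\<close> evaluates the inner integral for any \<open>c > 0\<close>. The remaining integrand is that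
  of \<open>hyp_integral\<close>, up to the power of \<open>s\<close>.
\<close>

lemma Laplace_bessel_K:
  fixes \<nu> \<mu> :: complex and s c :: real
  assumes s: "0 < s" and c: "0 < c" and re: "Re (\<nu> + \<mu>) > -1" "Re (\<nu> - \<mu>) > -1"
  defines "f \<equiv> \<lambda>t. of_real (exp (- t * c)) * of_real t powr \<nu> * bessel_K \<mu> (of_real (t * s))"
  shows "set_integrable lborel {0<..} f"
    and "(LBINT t:{0<..}. f t) = Gamma (\<nu> + 1) / 2 * of_real s powr (- (\<nu> + 1)) *
           hyp_integral (\<nu> + 1) \<mu> (of_real ((1 - c / s) / 2))"
proof -
  define a where "a = \<nu> + 1"
  define p where "p v = c + s * cosh v" for v :: real
  define q where "q v = exp (- \<mu> * of_real v) / 2" for v :: real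
  have a: "\<bar>Re \<mu>\<bar> < Re a" "Re a > 0"
    using re by (auto simp: a_def)
  have p_ge: "s / 2 * exp \<bar>v\<bar> \<le> p v" for v
  proof -
    have "s * (exp \<bar>v\<bar> / 2) \<le> s * cosh v"
      using s by (intro mult_left_mono exp_abs_le_cosh) simp
    then show ?thesis
      unfolding p_def using c by linarith
  qed
  have p_pos: "p v > 0" for v
    using p_ge[of v] s by (smt (verit) exp_gt_zero mult_pos_pos half_gt_zero)
  have contp: "continuous_on UNIV p" and contq: "continuous_on UNIV q"
    unfolding p_def q_def by (intro continuous_intros; simp)+
  have "integrable lborel (\<lambda>v. norm (exp (- \<mu> * of_real v)) * p v powr (- Re a) / 2)"
    using s by (intro integrable_divide integrable_exp_powr[OF _ p_ge contp a(1)]) auto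
  then have int: "integrable lborel (\<lambda>v. norm (q v) * p v powr (- Re a))"
    by (simp add: q_def norm_divide)
  have f_eq: "f t = of_real t powr (a - 1) * (\<integral>v. of_real (exp (- t * p v)) * q v \<partial>lborel)" if t: "t > 0" for t
  proof -
    have "of_real (exp (- t * p v)) * q v = of_real (exp (- t * c)) / 2 * K_kernel \<mu> (of_real (t * s)) v" for v
      unfolding p_def q_def K_kernel_def exp_of_real[symmetric] times_divide_eq_left times_divide_eq_right
        exp_add[symmetric]
      by (rule arg_cong[where f = "\<lambda>x. exp x / 2"]) (simp add: algebra_simps)
    then have "(\<integral>v. of_real (exp (- t * p v)) * q v \<partial>lborel) =
                 of_real (exp (- t * c)) * K_integral \<mu> (of_real (t * s))"
      by (simp only: integral_mult_right_zero K_integral_def) simp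
    then show ?thesis
      using t s by (simp add: f_def a_def bessel_K_eq_integral)
  qed
  note F = Laplace_powr_Fubini[OF a(2) p_pos contp contq int]
  show "set_integrable lborel {0<..} f"
  proof (rule iffD2[OF set_integrable_cong[OF refl refl] F(1)])
    show "f t = of_real t powr (a - 1) * (\<integral>v. of_real (exp (- t * p v)) * q v \<partial>lborel)" if "t \<in> {0<..}" for t
      using that by (intro f_eq) simp
  qed
  have "(LBINT t:{0<..}. f t) = Gamma a * (\<integral>v. q v * of_real (p v) powr (- a) \<partial>lborel)"
    unfolding F(2)[symmetric]
    by (rule set_lebesgue_integral_cong) (simp, intro allI impI f_eq, simp)
  also have "(\<lambda>v. q v * of_real (p v) powr (- a)) = (\<lambda>v. of_real s powr (- a) / 2 *
      (cosh_weight a \<mu> v * (1 - of_real ((1 - c / s) / 2) * of_real (cosh_ratio v)) powr (- a)))"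
  proof
    fix v :: real
    define r where "r = 1 - (1 - c / s) / 2 * cosh_ratio v"
    have split: "p v = s * ((1 + cosh v) * r)"
    proof -
      have "(1 + cosh v) * r = 1 + cosh v - (1 - c / s)"
      proof -
        have "D * (1 - y / 2 * (2 / D)) = D - y" if "D > 0" for D y :: real
          using that by (simp add: field_simps)
        from this[OF one_plus_cosh_pos] show ?thesis
          unfolding r_def cosh_ratio_def .
      qed
      then show ?thesis
        using s by (simp add: p_def field_simps)
    qed
    then have r: "r > 0"
      using p_pos[of v] s one_plus_cosh_pos[of v] by (simp add: zero_less_mult_iff)
    have "of_real (p v) powr (- a) = of_real s powr (- a) * (of_real (1 + cosh v) powr (- a) * of_real r powr (- a))"
    proof -
      have "ln (p v) = ln s + (ln (1 + cosh v) + ln r)"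
        unfolding split using s r one_plus_cosh_pos[of v] by (simp only: ln_mult_pos mult_pos_pos)
      then show ?thesis
        unfolding of_real_powr_eq_exp[OF p_pos] of_real_powr_eq_exp[OF s] of_real_powr_eq_exp[OF r]
          of_real_powr_eq_exp[OF one_plus_cosh_pos] exp_add[symmetric]
        by (intro arg_cong[where f = exp]) (simp add: algebra_simps)
    qed
    moreover have "1 - of_real ((1 - c / s) / 2) * of_real (cosh_ratio v) = complex_of_real r"
      by (simp add: r_def)
    ultimately show "q v * of_real (p v) powr (- a) = of_real s powr (- a) / 2 *
        (cosh_weight a \<mu> v * (1 - of_real ((1 - c / s) / 2) * of_real (cosh_ratio v)) powr (- a))"
      by (simp only: q_def cosh_weight_def) simp
  qed
  finally show "(LBINT t:{0<..}. f t) = Gamma (\<nu> + 1) / 2 * of_real s powr (- (\<nu> + 1)) *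
           hyp_integral (\<nu> + 1) \<mu> (of_real ((1 - c / s) / 2))"
    by (simp add: hyp_integral_def a_def)
qed

section \<open>Legendre functions at the hyperbolic cotangent\<close>

lemma sqrt_2_eq_exp: "sqrt 2 = exp (ln 2 / 2)"
  by (rule real_sqrt_unique) (simp_all add: power2_eq_square flip: exp_add)

text \<open>
  All powers have positive bases, so that both sides are compared through the logarithms of \<open>2\<close>,
  \<open>s\<close> and \<open>c\<close>; the relation \<open>c\<^sup>2 - s\<^sup>2 = 1\<close> enters as \<open>(c / s)\<^sup>2 - 1 = s powr (- 2)\<close>.
\<close>

lemma legendre_Q_coth:
  assumes c: "c > 0" and s: "s > (0::real)" and cs: "c\<^sup>2 - s\<^sup>2 = 1"
  shows "of_real (sqrt (2 / pi)) * of_real (s powr (- 1 / 2)) * exp (- (\<nu> + 1 / 2) * of_real pi * \<i>) *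
           legendre_Q (\<mu> - 1 / 2) (\<nu> + 1 / 2) (c / s) =
         of_real (s / 2) powr \<mu> * Gamma (\<nu> + \<mu> + 1) * of_real c powr (- (\<nu> + \<mu> + 1)) *
           hypergeom_reg_series ((\<nu> + \<mu> + 1) / 2) ((\<nu> + \<mu> + 1 + 1) / 2) (\<mu> + 1) (of_real ((s / c)\<^sup>2))"
proof -
  define H where "H = hypergeom_reg_series ((\<nu> + \<mu> + 1) / 2) ((\<nu> + \<mu> + 1 + 1) / 2) (\<mu> + 1) (of_real ((s / c)\<^sup>2))"
  have "hypergeom_reg_series ((\<mu> - 1 / 2 + (\<nu> + 1 / 2)) / 2 + 1) ((\<mu> - 1 / 2 + (\<nu> + 1 / 2) + 1) / 2)
          (\<mu> - 1 / 2 + 3 / 2) (of_real (1 / (c / s)\<^sup>2)) = H"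
  proof -
    have "1 / (c / s)\<^sup>2 = (s / c)\<^sup>2" "(\<mu> - 1 / 2 + (\<nu> + 1 / 2)) / 2 + 1 = (\<nu> + \<mu> + 1 + 1) / 2"
      "(\<mu> - 1 / 2 + (\<nu> + 1 / 2) + 1) / 2 = (\<nu> + \<mu> + 1) / 2" "\<mu> - 1 / 2 + 3 / 2 = \<mu> + 1"
      by (simp_all add: power_divide field_simps)
    then show ?thesis
      by (simp only: H_def) (simp add: hypergeom_reg_series_def mult_ac)
  qed
  moreover have "\<mu> - 1 / 2 + (\<nu> + 1 / 2) + 1 = \<nu> + \<mu> + 1" "\<mu> - 1 / 2 + 1 = \<mu> + 1 / 2"
    by simp_all
  moreover have "(c / s)\<^sup>2 - 1 = s powr (- 2)"
    using s cs by (simp add: powr_minus powr_numeral field_simps)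
  ultimately have Q: "legendre_Q (\<mu> - 1 / 2) (\<nu> + 1 / 2) (c / s) =
      exp ((\<nu> + 1 / 2) * of_real pi * \<i>) * Gamma (\<nu> + \<mu> + 1) *
      (of_real (sqrt pi) * of_real (s powr (- 2)) powr ((\<nu> + 1 / 2) / 2) /
       (2 powr (\<mu> + 1 / 2) * of_real (c / s) powr (\<nu> + \<mu> + 1))) * H"
    unfolding legendre_Q_def by (simp only:)
  have "sqrt (2 / pi) * sqrt pi = exp (ln 2 / 2)"
    by (simp add: real_sqrt_divide sqrt_2_eq_exp)
  then have "complex_of_real (sqrt (2 / pi) * sqrt pi) = exp (of_real (ln 2) / 2)"
    by (simp only: exp_of_real[symmetric]) simp
  then have sq: "complex_of_real (sqrt (2 / pi)) * of_real (sqrt pi) = exp (of_real (ln 2) / 2)"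
    by simp
  have two: "2 powr x = exp (x * complex_of_real (ln 2))" for x
    using of_real_powr_eq_exp[of 2 x] by simp
  have e: "exp (- (\<nu> + 1 / 2) * of_real pi * \<i>) * exp ((\<nu> + 1 / 2) * of_real pi * \<i>) = 1"
    by (simp add: algebra_simps flip: exp_add)
  have "exp (of_real (ln 2) / 2) * of_real (s powr (- 1 / 2)) * (of_real (s powr (- 2)) powr ((\<nu> + 1 / 2) / 2) /
       (2 powr (\<mu> + 1 / 2) * of_real (c / s) powr (\<nu> + \<mu> + 1))) =
     of_real (s / 2) powr \<mu> * of_real c powr (- (\<nu> + \<mu> + 1))"
  proof -
    have ss: "complex_of_real (s powr x) = exp (of_real x * of_real (ln s))" for x
      using s by (simp add: powr_def flip: exp_of_real)
    have 1: "of_real (s powr (- 2)) powr x = exp (x * complex_of_real (- 2 * ln s))" for x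
      using s by (subst of_real_powr_eq_exp) (auto simp: ln_powr)
    have 2: "of_real (c / s) powr x = exp (x * complex_of_real (ln c - ln s))" for x
      using s c by (subst of_real_powr_eq_exp) (auto simp: ln_divide_pos)
    have 3: "of_real (s / 2) powr x = exp (x * complex_of_real (ln s - ln 2))" for x
      using s by (subst of_real_powr_eq_exp) (auto simp: ln_divide_pos)
    show ?thesis
      unfolding 1 2 3
      unfolding ss two of_real_powr_eq_exp[OF c] exp_add[symmetric] exp_diff[symmetric]
      by (rule arg_cong[where f = exp]) (simp add: field_simps)
  qed
  note pw = this
  have "of_real (sqrt (2 / pi)) * of_real (s powr (- 1 / 2)) * exp (- (\<nu> + 1 / 2) * of_real pi * \<i>) *
          legendre_Q (\<mu> - 1 / 2) (\<nu> + 1 / 2) (c / s) =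
        (complex_of_real (sqrt (2 / pi)) * of_real (sqrt pi)) * of_real (s powr (- 1 / 2)) *
          (of_real (s powr (- 2)) powr ((\<nu> + 1 / 2) / 2) / (2 powr (\<mu> + 1 / 2) * of_real (c / s) powr (\<nu> + \<mu> + 1))) *
          (exp (- (\<nu> + 1 / 2) * of_real pi * \<i>) * exp ((\<nu> + 1 / 2) * of_real pi * \<i>)) * Gamma (\<nu> + \<mu> + 1) * H"
    unfolding Q by (simp only: mult_ac times_divide_eq_left times_divide_eq_right)
  also have "\<dots> = of_real (s / 2) powr \<mu> * of_real c powr (- (\<nu> + \<mu> + 1)) * Gamma (\<nu> + \<mu> + 1) * H"
    unfolding sq e pw by simp
  finally show ?thesis
    unfolding H_def[symmetric] by (simp only: mult_ac)
qed

text \<open>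
  Here \<open>c\<^sup>2 - s\<^sup>2 = 1\<close> gives \<open>(x + 1) / (x - 1) = (c + s)\<^sup>2\<close> for \<open>x = c / s\<close>, while
  \<open>1 - z = (c + s) / (2 * s)\<close>. The powers of \<open>c + s\<close> in the prefactor of \<open>P\<close> and in Euler's factor
  therefore cancel.
\<close>

lemma legendre_P_coth:
  assumes c: "c > 0" and s: "s > (0::real)" and cs: "c\<^sup>2 - s\<^sup>2 = 1" and a: "\<bar>Re \<mu>\<bar> < Re (\<nu> + 1)"
  shows "of_real (sqrt (pi / 2)) * Gamma (\<nu> + \<mu> + 1) * Gamma (\<nu> - \<mu> + 1) * of_real (s powr (- 1 / 2)) *
           legendre_P (\<mu> - 1 / 2) (- \<nu> - 1 / 2) (c / s) =
         Gamma (\<nu> + 1) / 2 * of_real s powr (- (\<nu> + 1)) * hyp_integral (\<nu> + 1) \<mu> (of_real ((1 - c / s) / 2))"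
proof -
  define z where "z = complex_of_real ((1 - c / s) / 2)"
  define J where "J = hyp_integral (\<nu> + 1) \<mu> z"
  define H where "H = hypergeom_reg (1 / 2 + \<mu>) (1 / 2 - \<mu>) (\<nu> + 1 + 1 / 2) z"
  define G where "G = Gamma (\<nu> + 1 - \<mu>) * Gamma (\<nu> + 1 + \<mu>)"
  have lt: "s < c"
  proof (rule power2_less_imp_less)
    show "s\<^sup>2 < c\<^sup>2"
      using cs by simp
  qed (use c in simp)
  have "Re z < 1"
    using lt s by (simp add: z_def field_simps)
  then have "z \<in> slit_plane"
    by (auto simp: slit_plane_def)
  from hypergeom_reg_eq_integral[OF a this]
  have E: "2 powr (1 - (\<nu> + 1)) * of_real (sqrt pi) * G * rGamma (\<nu> + 1) * H = (1 - z) powr (\<nu> + 1 - 1 / 2) * J"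
    unfolding H_def J_def G_def by (simp only: mult_ac)
  have "Re (\<nu> + 1) > 0"
    using a by linarith
  then have Gam: "Gamma (\<nu> + 1) * rGamma (\<nu> + 1) = 1"
    using not_nonpos_Int_if_Re_pos[of "\<nu> + 1"] by (simp add: rGamma_inverse_Gamma Gamma_eq_zero_iff)
  have "\<mu> - 1 / 2 + 1 = 1 / 2 + \<mu>" "- (\<mu> - 1 / 2) = 1 / 2 - \<mu>" "1 - (- \<nu> - 1 / 2) = \<nu> + 1 + 1 / 2"
    by simp_all
  then have P: "legendre_P (\<mu> - 1 / 2) (- \<nu> - 1 / 2) (c / s) =
      of_real ((c / s + 1) / (c / s - 1)) powr ((- \<nu> - 1 / 2) / 2) * H"
    unfolding legendre_P_def H_def z_def by (simp only:)
  have two: "2 powr x = exp (x * complex_of_real (ln 2))" for x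
    using of_real_powr_eq_exp[of 2 x] by simp
  have "sqrt (pi / 2) = sqrt pi * inverse (exp (ln 2 / 2))"
    unfolding real_sqrt_divide sqrt_2_eq_exp by (rule divide_inverse)
  then have "sqrt (pi / 2) = sqrt pi * exp (- ln 2 / 2)"
    by (simp only: exp_minus[symmetric] minus_divide_left)
  then have sq: "complex_of_real (sqrt (pi / 2)) = of_real (sqrt pi) * exp (- of_real (ln 2) / 2)"
    by (simp only: of_real_mult exp_of_real[symmetric] of_real_divide of_real_minus of_real_numeral)
  have pw: "exp (- of_real (ln 2) / 2) * of_real (s powr (- 1 / 2)) *
      of_real ((c / s + 1) / (c / s - 1)) powr ((- \<nu> - 1 / 2) / 2) * (1 - z) powr (\<nu> + 1 - 1 / 2) =
      2 powr (1 - (\<nu> + 1)) * (of_real s powr (- (\<nu> + 1)) / 2)"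
  proof -
    have ss: "complex_of_real (s powr x) = exp (of_real x * of_real (ln s))" for x
      using s by (simp add: powr_def flip: exp_of_real)
    have "(c / s + 1) / (c / s - 1) = (c + s) / (c - s)"
      using s lt by (simp add: field_simps)
    also have "c - s = 1 / (c + s)"
    proof -
      have "(c - s) * (c + s) = 1"
        using cs by algebra
      then show ?thesis
        using c s by (simp add: nonzero_eq_divide_eq)
    qed
    finally have "ln ((c / s + 1) / (c / s - 1)) = ln ((c + s)\<^sup>2)"
      by (simp only: power2_eq_square divide_divide_eq_right div_by_1)
    also have "\<dots> = 2 * ln (c + s)"
      using c s by (simp add: ln_realpow)
    finally have "ln ((c / s + 1) / (c / s - 1)) = 2 * ln (c + s)" .
    moreover have "0 < (c / s + 1) / (c / s - 1)"
    proof -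
      have "1 < c / s"
        using lt s by simp
      then show ?thesis
        by (intro divide_pos_pos) linarith+
    qed
    ultimately have 1: "of_real ((c / s + 1) / (c / s - 1)) powr x = exp (x * complex_of_real (2 * ln (c + s)))" for x
      by (simp only: of_real_powr_eq_exp)
    have "1 - (1 - c / s) / 2 = (c + s) / (2 * s)"
      using s by (simp add: field_simps)
    then have "complex_of_real (1 - (1 - c / s) / 2) = of_real ((c + s) / (2 * s))"
      by (rule arg_cong)
    then have "1 - z = of_real ((c + s) / (2 * s))"
      by (simp only: z_def of_real_diff of_real_1)
    moreover have "ln ((c + s) / (2 * s)) = ln (c + s) - (ln 2 + ln s)"
      using s c by (simp add: ln_divide_pos ln_mult_pos)
    moreover have "0 < (c + s) / (2 * s)"
      using s c by simp
    ultimately have 2: "(1 - z) powr x = exp (x * complex_of_real (ln (c + s) - (ln 2 + ln s)))" for x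
      by (simp only: of_real_powr_eq_exp)
    have "exp (of_real (- ln 2)) = complex_of_real (1 / 2)"
      unfolding exp_of_real by (simp add: exp_minus)
    then have half: "of_real s powr x / 2 = exp (x * complex_of_real (ln s)) * exp (of_real (- ln 2))" for x
      unfolding of_real_powr_eq_exp[OF s] by simp
    show ?thesis
      unfolding 1 2 ss half two exp_add[symmetric]
      by (rule arg_cong[where f = exp]) (simp add: field_simps)
  qed
  have "of_real (sqrt (pi / 2)) * Gamma (\<nu> + \<mu> + 1) * Gamma (\<nu> - \<mu> + 1) * of_real (s powr (- 1 / 2)) *
           legendre_P (\<mu> - 1 / 2) (- \<nu> - 1 / 2) (c / s) =
        (exp (- of_real (ln 2) / 2) * of_real (s powr (- 1 / 2)) *
         of_real ((c / s + 1) / (c / s - 1)) powr ((- \<nu> - 1 / 2) / 2)) * (of_real (sqrt pi) * G * H)"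
  proof -
    have "\<nu> + \<mu> + 1 = \<nu> + 1 + \<mu>" "\<nu> - \<mu> + 1 = \<nu> + 1 - \<mu>"
      by simp_all
    then show ?thesis
      unfolding P sq G_def by (simp only: mult_ac)
  qed
  also have "of_real (sqrt pi) * G * H = Gamma (\<nu> + 1) * 2 powr (- (1 - (\<nu> + 1))) * ((1 - z) powr (\<nu> + 1 - 1 / 2) * J)"
  proof -
    have "2 powr (- (1 - (\<nu> + 1))) * 2 powr (1 - (\<nu> + 1)) = (1 :: complex)"
      unfolding powr_add[symmetric] by simp
    then have "of_real (sqrt pi) * G * H = (2 powr (- (1 - (\<nu> + 1))) * 2 powr (1 - (\<nu> + 1))) *
        (Gamma (\<nu> + 1) * rGamma (\<nu> + 1)) * (of_real (sqrt pi) * G * H)"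
      unfolding Gam by simp
    then show ?thesis
      unfolding E[symmetric] by (simp only: mult_ac)
  qed
  also have "(exp (- of_real (ln 2) / 2) * of_real (s powr (- 1 / 2)) *
         of_real ((c / s + 1) / (c / s - 1)) powr ((- \<nu> - 1 / 2) / 2)) *
         (Gamma (\<nu> + 1) * 2 powr (- (1 - (\<nu> + 1))) * ((1 - z) powr (\<nu> + 1 - 1 / 2) * J)) =
       (2 powr (1 - (\<nu> + 1)) * (of_real s powr (- (\<nu> + 1)) / 2)) * (Gamma (\<nu> + 1) * 2 powr (- (1 - (\<nu> + 1))) * J)"
    unfolding pw[symmetric] by (simp only: mult_ac)
  also have "\<dots> = (2 powr (1 - (\<nu> + 1)) * 2 powr (- (1 - (\<nu> + 1)))) * (Gamma (\<nu> + 1) / 2 * of_real s powr (- (\<nu> + 1)) * J)"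
    by (simp only: mult_ac times_divide_eq_left times_divide_eq_right)
  also have "2 powr (1 - (\<nu> + 1)) * 2 powr (- (1 - (\<nu> + 1))) = (1 :: complex)"
    unfolding powr_add[symmetric] by simp
  finally show ?thesis
    by (simp only: J_def z_def mult_1_left)
qed

theorem theorem2p2:
  fixes \<nu> \<mu> :: complex and \<xi> :: real
  assumes "\<xi> > 0"
  shows "(Re (\<nu> + \<mu>) > -1 \<longrightarrow>
      set_integrable lborel {0<..} (\<lambda>t::real.
        of_real (exp (- t * cosh \<xi>)) * of_real t powr \<nu> * bessel_I \<mu> (of_real (t * sinh \<xi>))) \<and>
      (LBINT t:{0<..}.
        of_real (exp (- t * cosh \<xi>)) * of_real t powr \<nu> * bessel_I \<mu> (of_real (t * sinh \<xi>))) =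
      of_real (sqrt (2 / pi)) * of_real (sinh \<xi> powr (- 1 / 2)) *
        exp (- (\<nu> + 1 / 2) * of_real pi * \<i>) *
        legendre_Q (\<mu> - 1 / 2) (\<nu> + 1 / 2) (cosh \<xi> / sinh \<xi>)) \<and>
    (Re (\<nu> + \<mu>) > -1 \<and> Re (\<nu> - \<mu>) > -1 \<longrightarrow>
      set_integrable lborel {0<..} (\<lambda>t::real.
        of_real (exp (- t * cosh \<xi>)) * of_real t powr \<nu> * bessel_K \<mu> (of_real (t * sinh \<xi>))) \<and>
      (LBINT t:{0<..}.
        of_real (exp (- t * cosh \<xi>)) * of_real t powr \<nu> * bessel_K \<mu> (of_real (t * sinh \<xi>))) =
      of_real (sqrt (pi / 2)) * Gamma (\<nu> + \<mu> + 1) * Gamma (\<nu> - \<mu> + 1) *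
        of_real (sinh \<xi> powr (- 1 / 2)) *
        legendre_P (\<mu> - 1 / 2) (- \<nu> - 1 / 2) (cosh \<xi> / sinh \<xi>))"
proof -
  have s: "0 < sinh \<xi>" "sinh \<xi> < cosh \<xi>" and c: "0 < cosh \<xi>"
    using assms sinh_less_cosh_real by auto
  have cs: "(cosh \<xi>)\<^sup>2 - (sinh \<xi>)\<^sup>2 = 1"
    by (rule hyperbolic_pythagoras)
  show ?thesis
  proof (intro conjI impI; (elim conjE)?)
    assume re: "Re (\<nu> + \<mu>) > -1"
    note L = Laplace_bessel_I[OF s re]
    show "set_integrable lborel {0<..} (\<lambda>t::real.
        of_real (exp (- t * cosh \<xi>)) * of_real t powr \<nu> * bessel_I \<mu> (of_real (t * sinh \<xi>)))"
      by (rule L(1))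
    show "(LBINT t:{0<..}.
        of_real (exp (- t * cosh \<xi>)) * of_real t powr \<nu> * bessel_I \<mu> (of_real (t * sinh \<xi>))) =
      of_real (sqrt (2 / pi)) * of_real (sinh \<xi> powr (- 1 / 2)) *
        exp (- (\<nu> + 1 / 2) * of_real pi * \<i>) *
        legendre_Q (\<mu> - 1 / 2) (\<nu> + 1 / 2) (cosh \<xi> / sinh \<xi>)"
      unfolding legendre_Q_coth[OF c s(1) cs] by (rule L(2))
  next
    assume re: "Re (\<nu> + \<mu>) > -1" "Re (\<nu> - \<mu>) > -1"
    then have a: "\<bar>Re \<mu>\<bar> < Re (\<nu> + 1)"
      by auto
    note L = Laplace_bessel_K[OF s(1) c re]
    show "set_integrable lborel {0<..} (\<lambda>t::real.
        of_real (exp (- t * cosh \<xi>)) * of_real t powr \<nu> * bessel_K \<mu> (of_real (t * sinh \<xi>)))"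
      by (rule L(1))
    show "(LBINT t:{0<..}.
        of_real (exp (- t * cosh \<xi>)) * of_real t powr \<nu> * bessel_K \<mu> (of_real (t * sinh \<xi>))) =
      of_real (sqrt (pi / 2)) * Gamma (\<nu> + \<mu> + 1) * Gamma (\<nu> - \<mu> + 1) *
        of_real (sinh \<xi> powr (- 1 / 2)) *
        legendre_P (\<mu> - 1 / 2) (- \<nu> - 1 / 2) (cosh \<xi> / sinh \<xi>)"
      unfolding legendre_P_coth[OF c s(1) cs a] by (rule L(2))
  qed
qed

end
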